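(* Let $(X_n)_{n\ge1}$ be i.i.d. random variables with finite second moment, $f_1(t)={\bf E}e^{itX_1}$, and $Z_n=(X_1+\dots+X_n)/\sqrt n$. The following are equivalent: (a) for some $n_0$, $Z_{n_0}$ has finite Fisher information; (b) for some $n_0$, $Z_{n_0}$ has a density of bounded total variation; (c) for some $n_0$, $Z_{n_0}$ has a continuously differentiable density $p_{n_0}$ with $\int_{-\infty}^{+\infty}|p_{n_0}'(x)|\,dx<+\infty$; (d) for some $\varepsilon>0$, $|f_1(t)|=O(t^{-\varepsilon})$ as $t\to+\infty$; (e) for some $\nu>0$, $\int_{-\infty}^{+\infty}|f_1(t)|^\nu|t|\,dt<+\infty$.
   Context: Fisher information of a random variable $X$: if $X$ has an absolutely continuous density $p$, $I(X)=\int_{\{p>0\}}p'(x)^2/p(x)\,dx$; otherwise $I(X)=+\infty$. The total variation of a density $p$ is $\|p\|_{TV}=\sup\sum_{k=1}^n|p(x_k)-p(x_{k-1})|$ over all finite $x_0<\dots<x_n$, with the convention that $p(x)$ lies in the closed segment between $p(x-)$ and $p(x+)$ for each $x$. *)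

theory Defs
  imports "HOL-Probability.Probability" "HOL-Library.Landau_Symbols"
begin

definition has_density :: "'a measure \<Rightarrow> ('a \<Rightarrow> real) \<Rightarrow> (real \<Rightarrow> real) \<Rightarrow> bool" where
  "has_density M Y p \<longleftrightarrow> (\<forall>x. 0 \<le> p x) \<and> distributed M lborel Y (\<lambda>x. ennreal (p x))"

definition loc_abs_cont :: "(real \<Rightarrow> real) \<Rightarrow> bool" where
  "loc_abs_cont p \<longleftrightarrow>
     (\<forall>a b. \<forall>e>0. \<exists>d>0. \<forall>(n::nat) (u::nat \<Rightarrow> real) v.
        (\<forall>k<n. a \<le> u k \<and> u k < v k \<and> v k \<le> b) \<and>
        (\<forall>k<n. \<forall>j<n. k \<noteq> j \<longrightarrow> v k \<le> u j \<or> v j \<le> u k) \<and>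
        (\<Sum>k<n. v k - u k) < d \<longrightarrow>
        (\<Sum>k<n. \<bar>p (v k) - p (u k)\<bar>) < e)"

definition finite_fisher_info :: "'a measure \<Rightarrow> ('a \<Rightarrow> real) \<Rightarrow> bool" where
  "finite_fisher_info M Y \<longleftrightarrow>
     (\<exists>p p'. has_density M Y p \<and> loc_abs_cont p \<and> p' \<in> borel_measurable borel \<and>
        (AE x in lborel. (p has_real_derivative p' x) (at x)) \<and>
        (\<integral>\<^sup>+ x. indicator {x. 0 < p x} x * ennreal ((p' x)\<^sup>2 / p x) \<partial>lborel) < \<infinity>)"

definition between_one_sided_limits :: "(real \<Rightarrow> real) \<Rightarrow> bool" where
  "between_one_sided_limits p \<longleftrightarrow>
     (\<forall>x. \<exists>l r. (p \<longlongrightarrow> l) (at_left x) \<and> (p \<longlongrightarrow> r) (at_right x) \<and>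
               min l r \<le> p x \<and> p x \<le> max l r)"

definition bounded_total_variation :: "(real \<Rightarrow> real) \<Rightarrow> bool" where
  "bounded_total_variation p \<longleftrightarrow>
     (\<exists>B. \<forall>(n::nat) (x::nat \<Rightarrow> real). (\<forall>k<n. x k < x (Suc k)) \<longrightarrow>
        (\<Sum>k<n. \<bar>p (x (Suc k)) - p (x k)\<bar>) \<le> B)"

end

theory Submission
  imports Defs
begin

text \<open>
  If \<open>p\<close> is a density of bounded variation \<open>V\<close>, shifting by \<open>\<pi> / t\<close> turns \<open>e\<^sup>i\<^sup>t\<^sup>x\<close> into its negative,
  so twice the modulus of the characteristic function at \<open>t\<close> is at most
  \<open>\<integral> |p(x + \<pi> / t) - p(x)| dx \<le> \<pi> V / t\<close>; as the characteristic function of \<open>Z\<^sub>n\<close> is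
  \<open>f\<^sub>1(t / \<surd>n)\<^sup>n\<close>, this gives (d). Both (a) and (c) imply (b) because \<open>p'\<close> is integrable:
  for (a), \<open>|p'| \<le> p'\<^sup>2 / p + p\<close>.

  Under (d), a high power of \<open>f\<^sub>1\<close> and its first two derivatives (which exist by the second moment)
  are \<open>O((1 + t\<^sup>2)\<^sup>-\<^sup>2)\<close>. By Fourier inversion and two integrations by parts \<open>Z\<^sub>n\<close> has a density whose
  first two derivatives are \<open>O((1 + x\<^sup>2)\<^sup>-\<^sup>1)\<close>. This is (c), and also (a), since a nonnegative \<open>p\<close>
  satisfies \<open>p'\<^sup>2 / p \<le> 2 (sup |p''| + |p'|)\<close> with the supremum over a unit neighbourhood.

  (e) follows from (d) by taking \<open>\<nu>\<close> large, and gives (d) because \<open>f\<^sub>1\<close> is Lipschitz: it stays above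
  \<open>|f\<^sub>1(t)| / 2\<close> on an interval of length proportional to \<open>|f\<^sub>1(t)|\<close>.
\<close>

subsection \<open>Fourier integrals\<close>

text \<open>The function \<open>h\<close> in the exponent stays general because two cases occur
  later: the identity gives characteristic functions, and \<open>uminus\<close> gives the inversion
  integral.\<close>

lemma integrable_mult_iexp:
  fixes g :: "'a \<Rightarrow> complex" and h :: "'a \<Rightarrow> real"
  assumes "integrable M g" "h \<in> borel_measurable M"
  shows "integrable M (\<lambda>x. g x * iexp (t * h x))"
proof (rule Bochner_Integration.integrable_bound[OF assms(1)])
  have [measurable]: "g \<in> borel_measurable M" "h \<in> borel_measurable M" using assms by auto
  show "(\<lambda>x. g x * iexp (t * h x)) \<in> borel_measurable M" by measurable
qed (auto simp: norm_mult simp del: of_real_mult)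

lemma norm_integral_iexp_le:
  fixes g :: "'a \<Rightarrow> complex" and h :: "'a \<Rightarrow> real"
  shows "norm (CLINT x|M. g x * iexp (t * h x)) \<le> (LINT x|M. norm (g x))"
  using integral_norm_bound[of M "\<lambda>x. g x * iexp (t * h x)"]
  by (simp add: norm_mult del: of_real_mult)

lemma isCont_integral_iexp:
  fixes g :: "'a \<Rightarrow> complex" and h :: "'a \<Rightarrow> real"
  assumes "integrable M g" "h \<in> borel_measurable M"
  shows "isCont (\<lambda>t. CLINT x|M. g x * iexp (t * h x)) t"
  unfolding continuous_at_sequentially
proof safe
  fix X assume X: "X \<longlonglongrightarrow> t"
  have [measurable]: "g \<in> borel_measurable M" "h \<in> borel_measurable M" using assms by auto
  show "((\<lambda>t. CLINT x|M. g x * iexp (t * h x)) \<circ> X) \<longlonglongrightarrow> (CLINT x|M. g x * iexp (t * h x))"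
    unfolding comp_def
    by (rule integral_dominated_convergence[where w="\<lambda>x. norm (g x)"])
       (use assms in \<open>auto intro!: tendsto_intros X simp: norm_mult simp del: of_real_mult\<close>)
qed

text \<open>Differentiation under the integral sign by dominated convergence along sequences: the
  error of the difference quotient tends to 0 pointwise, and integrability of
  \<open>h x * g x\<close> supplies the majorant.\<close>

lemma has_vector_derivative_integral_iexp:
  fixes g :: "'a \<Rightarrow> complex" and h :: "'a \<Rightarrow> real"
  assumes g: "integrable M g" and h: "h \<in> borel_measurable M" and gh: "integrable M (\<lambda>x. h x * g x)"
  shows "((\<lambda>t. CLINT x|M. g x * iexp (t * h x)) has_vector_derivative
          (CLINT x|M. (\<i> * (h x * g x)) * iexp (t * h x))) (at t)"
proof -
  have [measurable]: "g \<in> borel_measurable M" "h \<in> borel_measurable M" using assms by auto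
  \<comment> \<open>This is the error of the difference quotient of \<open>iexp (d * y)\<close> at
    \<open>d = 0\<close>. The bound \<open>r1\<close> makes it vanish in the limit for fixed
    \<open>y\<close>; the bound \<open>r2\<close> is uniform in \<open>d\<close> and provides the
    domination.\<close>
  define r :: "real \<Rightarrow> real \<Rightarrow> complex" where "r d y = (iexp (d * y) - (1 + \<i> * (d * y))) / d" for d y
  have r_eq: "iexp u - (\<Sum>k\<le>1. (\<i> * complex_of_real u)^k / fact k) = iexp u - (1 + \<i> * u)" for u
    by simp
  have r1: "norm (r d y) \<le> \<bar>d\<bar> * y\<^sup>2" if "d \<noteq> 0" for d y
  proof -
    have eq: "\<bar>d*y\<bar>^2 = \<bar>d\<bar> * (\<bar>d\<bar> * y\<^sup>2)"
      by (simp add: power2_eq_square abs_mult_self_eq flip: mult.assoc)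
    have "norm (iexp (d*y) - (1 + \<i> * (d*y))) \<le> \<bar>d*y\<bar>^2 / 2"
      using iexp_approx1[of "d*y" 1] unfolding r_eq by (simp add: numeral_2_eq_2)
    also have "\<dots> \<le> \<bar>d\<bar> * (\<bar>d\<bar> * y\<^sup>2)"
      unfolding eq by simp
    finally show ?thesis using that by (simp add: r_def norm_divide field_simps)
  qed
  have r2: "norm (r d y) \<le> 2 * \<bar>y\<bar>" if "d \<noteq> 0" for d y
  proof -
    have "norm (iexp (d*y) - (1 + \<i> * (d*y))) \<le> 2 * \<bar>d*y\<bar>"
      using iexp_approx2[of "d*y" 1] unfolding r_eq by simp
    then show ?thesis using that by (simp add: r_def norm_divide abs_mult field_simps)
  qed
  have int: "integrable M (\<lambda>x. (\<i> * (h x * g x)) * iexp (t * h x))"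
    using gh by (intro integrable_mult_iexp integrable_mult_right) auto
  note int' = integrable_mult_iexp[OF g h]
  let ?F = "\<lambda>t. CLINT x|M. g x * iexp (t * h x)"
  let ?D = "CLINT x|M. (\<i> * (h x * g x)) * iexp (t * h x)"
  have key: "(?F (t + d) - ?F t - d *\<^sub>R ?D) /\<^sub>R d = (CLINT x|M. g x * iexp (t * h x) * r d (h x))"
    if "d \<noteq> 0" for d
  proof -
    have "(?F (t + d) - ?F t - d *\<^sub>R ?D) /\<^sub>R d =
      (CLINT x|M. (g x * iexp ((t+d) * h x) - g x * iexp (t * h x) - d *\<^sub>R ((\<i> * (h x * g x)) * iexp (t * h x))) /\<^sub>R d)"
      using int int'[of t] int'[of "t+d"]
      by (simp del: of_real_mult of_real_add exp_of_real)
    also have "\<dots> = (CLINT x|M. g x * iexp (t * h x) * r d (h x))"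
      using that by (intro Bochner_Integration.integral_cong)
        (auto simp: r_def scaleR_conv_of_real divide_simps algebra_simps exp_add)
    finally show ?thesis .
  qed
  show ?thesis
    unfolding has_vector_derivative_def has_derivative_at tendsto_at_iff_sequentially
  proof (intro conjI allI impI)
    show "bounded_linear (\<lambda>x. x *\<^sub>R ?D)" by (rule bounded_linear_scaleR_left)
    fix X :: "nat \<Rightarrow> real" assume X: "\<forall>i. X i \<in> UNIV - {0}" "X \<longlonglongrightarrow> 0"
    have "(\<lambda>i. CLINT x|M. g x * iexp (t * h x) * r (X i) (h x)) \<longlonglongrightarrow> (CLINT x|M. 0)"
    proof (rule integral_dominated_convergence[where w="\<lambda>x. 2 * norm (h x * g x)"])
      have *: "(\<lambda>i. norm (g x) * (\<bar>X i\<bar> * (h x)\<^sup>2)) \<longlonglongrightarrow> norm (g x) * (\<bar>0\<bar> * (h x)\<^sup>2)" for x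
        by (intro tendsto_intros X)
      show "AE x in M. (\<lambda>i. g x * iexp (t * h x) * r (X i) (h x)) \<longlonglongrightarrow> 0"
      proof (rule AE_I2)
        fix x
        show "(\<lambda>i. g x * iexp (t * h x) * r (X i) (h x)) \<longlonglongrightarrow> 0"
          by (rule Lim_null_comparison[where g="\<lambda>i. norm (g x) * (\<bar>X i\<bar> * (h x)\<^sup>2)"])
             (use X r1 * in \<open>auto simp: norm_mult mult_left_mono simp del: of_real_mult\<close>)
      qed
      show "AE x in M. norm (g x * iexp (t * h x) * r (X i) (h x)) \<le> 2 * norm (h x * g x)" for i
      proof (rule AE_I2)
        fix x
        have "norm (g x) * norm (r (X i) (h x)) \<le> norm (g x) * (2 * \<bar>h x\<bar>)"
          using X r2 by (intro mult_left_mono) auto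
        then show "norm (g x * iexp (t * h x) * r (X i) (h x)) \<le> 2 * norm (h x * g x)"
          by (simp add: norm_mult mult_ac del: of_real_mult)
      qed
    qed (use gh in \<open>auto simp: r_def\<close>)
    then have "(\<lambda>i. norm (CLINT x|M. g x * iexp (t * h x) * r (X i) (h x))) \<longlonglongrightarrow> 0"
      by (simp add: tendsto_norm_zero)
    moreover have "norm (CLINT x|M. g x * iexp (t * h x) * r (X i) (h x))
        = norm (?F (t + X i) - ?F t - X i *\<^sub>R ?D) / norm (X i)" for i
      using X by (subst key[symmetric]) (auto simp: divide_inverse mult.commute)
    ultimately show "((\<lambda>y. norm (?F (t + y) - ?F t - y *\<^sub>R ?D) / norm y) \<circ> X) \<longlonglongrightarrow> 0"
      by (simp add: comp_def)
  qed
qed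

section \<open>Domination by multiples of \<open>1 / (1 + t^2)\<close> and integration by parts on
  the line\<close>

lemma integrable_inverse_1_plus_square_lborel:
  "integrable lborel (\<lambda>x::real. 1 / (1 + x\<^sup>2))"
  using integrable_inverse_1_plus_square by (simp add: set_integrable_def einterval_def inverse_eq_divide)

lemma integrable_of_norm_le_1_plus_square:
  fixes F :: "real \<Rightarrow> 'a::{banach, second_countable_topology}"
  assumes "F \<in> borel_measurable borel" "\<And>t. norm (F t) \<le> K / (1 + t\<^sup>2)"
  shows "integrable lborel F"
proof (rule Bochner_Integration.integrable_bound)
  show "integrable lborel (\<lambda>t::real. K * (1 / (1 + t\<^sup>2)))"
    by (intro integrable_mult_right integrable_inverse_1_plus_square_lborel)
  show "AE x in lborel. norm (F x) \<le> norm (K * (1 / (1 + x\<^sup>2)))"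
  proof (rule AE_I2)
    fix t show "norm (F t) \<le> norm (K * (1 / (1 + t\<^sup>2)))"
      using assms(2)[of t] abs_ge_self[of "K / (1 + t\<^sup>2)"] by (simp only: real_norm_def times_divide_eq_right mult_1_right)
  qed
qed (use assms(1) in simp)

lemma tendsto_zero_of_norm_le_1_plus_square:
  fixes F :: "real \<Rightarrow> complex"
  assumes "\<And>t. norm (F t) \<le> K / (1 + t\<^sup>2)"
  shows "(F \<longlongrightarrow> 0) at_top" "(F \<longlongrightarrow> 0) at_bot"
proof -
  have "((\<lambda>t::real. K / (1 + t\<^sup>2)) \<longlongrightarrow> 0) F" if "filterlim (\<lambda>t::real. t\<^sup>2) at_top F" for F
    by (intro real_tendsto_divide_at_top[OF tendsto_const] filterlim_tendsto_add_at_top[OF tendsto_const] that)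
  then have "((\<lambda>t::real. K / (1 + t\<^sup>2)) \<longlongrightarrow> 0) at_top" "((\<lambda>t::real. K / (1 + t\<^sup>2)) \<longlongrightarrow> 0) at_bot"
    by (simp_all add: filterlim_pow_at_top filterlim_ident filterlim_pow_at_bot_even)
  then show "(F \<longlongrightarrow> 0) at_top" "(F \<longlongrightarrow> 0) at_bot"
    using Lim_null_comparison[of F "\<lambda>t. K / (1 + t\<^sup>2)"] assms by simp_all
qed

text \<open>The fundamental theorem of calculus on the whole line; the decay of \<open>F\<close>
  makes both boundary values 0.\<close>

lemma integral_vector_derivative_eq_0:
  fixes F F' :: "real \<Rightarrow> complex"
  assumes D: "\<And>t. (F has_vector_derivative F' t) (at t)" and C: "\<And>t. isCont F' t"
    and B: "\<And>t. norm (F t) \<le> K / (1 + t\<^sup>2)" "\<And>t. norm (F' t) \<le> K' / (1 + t\<^sup>2)"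
  shows "(CLINT t|lborel. F' t) = 0"
proof -
  have "F' \<in> borel_measurable borel"
    using C by (intro borel_measurable_continuous_onI) (simp add: continuous_at_imp_continuous_on)
  then have int: "integrable lborel F'"
    using B by (intro integrable_of_norm_le_1_plus_square)
  have "(LBINT t=-\<infinity>..\<infinity>. F' t) = 0 - 0"
    by (rule interval_integral_FTC_integrable[where F=F])
       (use D C int tendsto_zero_of_norm_le_1_plus_square[OF B(1)] in
         \<open>auto simp: ereal_tendsto_simps einterval_def set_integrable_def\<close>)
  then show ?thesis by (simp add: interval_lebesgue_integral_def set_lebesgue_integral_def einterval_def)
qed

text \<open>Integration by parts: the derivative of \<open>F t * iexp (x * - t)\<close> has integral
  0, and its two terms give the two sides.\<close>

lemma fourier_derivative:
  fixes F F' :: "real \<Rightarrow> complex"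
  assumes D: "\<And>t. (F has_vector_derivative F' t) (at t)" and C: "\<And>t. isCont F' t"
    and B: "\<And>t. norm (F t) \<le> K / (1 + t\<^sup>2)" "\<And>t. norm (F' t) \<le> K / (1 + t\<^sup>2)"
  shows "(CLINT t|lborel. F' t * iexp (x * - t)) = \<i> * x * (CLINT t|lborel. F t * iexp (x * - t))"
proof -
  have CF: "isCont F t" for t using D has_vector_derivative_continuous by blast
  have meas: "F' \<in> borel_measurable borel" "F \<in> borel_measurable borel"
    using C CF by (auto intro!: borel_measurable_continuous_onI continuous_at_imp_continuous_on)
  have int: "integrable lborel F'" "integrable lborel F"
    using B meas by (auto intro: integrable_of_norm_le_1_plus_square)
  have "(CLINT t|lborel. F' t * iexp (x * - t) - \<i> * x * (F t * iexp (x * - t))) = 0"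
  proof (rule integral_vector_derivative_eq_0)
    fix t
    show "((\<lambda>t. F t * iexp (x * - t)) has_vector_derivative
        F' t * iexp (x * - t) - \<i> * x * (F t * iexp (x * - t))) (at t)"
      by (rule derivative_eq_intros has_vector_derivative_real_field D refl | simp)+
    show "isCont (\<lambda>t. F' t * iexp (x * - t) - \<i> * x * (F t * iexp (x * - t))) t"
      by (intro continuous_intros C CF)
    show "norm (F t * iexp (x * - t)) \<le> K / (1 + t\<^sup>2)"
      using B by (simp add: norm_mult del: of_real_mult)
    have "norm (F' t * iexp (x * - t) - \<i> * x * (F t * iexp (x * - t))) \<le>
       norm (F' t) + \<bar>x\<bar> * norm (F t)"
      by (rule order_trans[OF norm_triangle_ineq4]) (simp add: norm_mult del: of_real_mult)
    also have "\<dots> \<le> K / (1 + t\<^sup>2) + \<bar>x\<bar> * (K / (1 + t\<^sup>2))"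
      by (intro add_mono mult_left_mono B) auto
    finally show "norm (F' t * iexp (x * - t) - \<i> * x * (F t * iexp (x * - t))) \<le> (K + \<bar>x\<bar> * K) / (1 + t\<^sup>2)"
      by (simp add: add_divide_distrib)
  qed
  moreover have "integrable lborel (\<lambda>t. G t * iexp (x * - t))" if "integrable lborel G" for G
    by (rule integrable_mult_iexp[OF that]) simp
  ultimately show ?thesis
    using int by (subst (asm) Bochner_Integration.integral_diff) auto
qed

text \<open>Two integrations by parts turn \<open>F2\<close> into multiplication of the transform of
  \<open>F\<close> by \<open>- x^2\<close>. The transforms of \<open>F\<close> and of
  \<open>F2\<close> are each at most \<open>K\<close> times the integral of
  \<open>1 / (1 + t^2)\<close>, and adding both bounds produces the factor
  \<open>1 + x^2\<close>.\<close>

lemma fourier_decay: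
  fixes F F1 F2 :: "real \<Rightarrow> complex"
  assumes D: "\<And>t. (F has_vector_derivative F1 t) (at t)" "\<And>t. (F1 has_vector_derivative F2 t) (at t)"
    and C: "\<And>t. isCont F2 t"
    and B: "\<And>t. norm (F t) \<le> K / (1 + t\<^sup>2)" "\<And>t. norm (F1 t) \<le> K / (1 + t\<^sup>2)" "\<And>t. norm (F2 t) \<le> K / (1 + t\<^sup>2)"
  shows "norm (CLINT t|lborel. F t * iexp (x * - t)) \<le> 2 * K * (LINT t|lborel. 1 / (1 + t\<^sup>2)) / (1 + x\<^sup>2)"
proof -
  let ?I = "\<lambda>F. CLINT t|lborel. F t * iexp (x * - t)"
  have CF: "isCont F t" "isCont F1 t" for t using D has_vector_derivative_continuous by blast+
  have "?I F1 = \<i> * x * ?I F" "?I F2 = \<i> * x * ?I F1"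
    using fourier_derivative[OF D(1) CF(2) B(1,2)] fourier_derivative[OF D(2) C B(2,3)] by auto
  then have "?I F2 = - (complex_of_real (x\<^sup>2) * ?I F)"
    by (simp add: power2_eq_square algebra_simps)
  then have F2: "norm (?I F2) = x\<^sup>2 * norm (?I F)"
    by (simp add: norm_mult norm_power)
  have bd: "norm (?I G) \<le> K * (LINT t|lborel. 1 / (1 + t\<^sup>2))"
    if "\<And>t. isCont G t" "\<And>t. norm (G t) \<le> K / (1 + t\<^sup>2)" for G
  proof -
    have "integrable lborel G"
      using that by (auto intro!: integrable_of_norm_le_1_plus_square borel_measurable_continuous_onI continuous_at_imp_continuous_on)
    then have "(LINT t|lborel. norm (G t)) \<le> (LINT t|lborel. K * (1 / (1 + t\<^sup>2)))"
      using that by (intro integral_mono integrable_mult_right integrable_inverse_1_plus_square_lborel) auto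
    then show ?thesis
      unfolding Bochner_Integration.integral_mult_right_zero
      by (rule order_trans[OF norm_integral_iexp_le])
  qed
  have "norm (?I F) + norm (?I F2) \<le> 2 * K * (LINT t|lborel. 1 / (1 + t\<^sup>2))"
    using bd[OF CF(1) B(1)] bd[OF C B(3)] by simp
  then show ?thesis unfolding F2
    by (simp add: pos_le_divide_eq add_pos_nonneg algebra_simps)
qed

subsection \<open>Fourier inversion for integrable characteristic functions\<close>

lemma integral_Icc_iexp:
  fixes a b t :: real
  assumes "a \<le> b" "t \<noteq> 0"
  shows "(CLINT x|lborel. indicator {a..b} x *\<^sub>R iexp (x * - t)) = (iexp (- (t * a)) - iexp (- (t * b))) / (\<i> * t)"
proof -
  have "(CLINT x|lborel. indicator {a..b} x *\<^sub>R iexp (x * - t)) = \<i> / t * iexp (b * - t) - \<i> / t * iexp (a * - t)"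
  proof (rule integral_FTC_atLeastAtMost[OF assms(1)])
    fix x
    show "((\<lambda>x. \<i> / t * iexp (x * - t)) has_vector_derivative iexp (x * - t)) (at x within {a..b})"
      by (rule derivative_eq_intros has_vector_derivative_real_field refl | simp)+
        (simp add: assms(2) mult.commute[of _ \<i>])
  qed (intro continuous_intros)
  also have "\<dots> = (iexp (- (t * a)) - iexp (- (t * b))) / (\<i> * t)"
    using assms(2) by (simp add: field_simps)
  finally show ?thesis .
qed

text \<open>Levy inversion is a limit of truncated integrals with kernel \<open>?k\<close>. This
  kernel is itself the integral of \<open>iexp (x * - t)\<close> over \<open>x\<close> in
  \<open>{a..b}\<close>, hence bounded by \<open>b - a\<close>; dominated convergence removes the
  truncation, and Fubini exchanges the two integrals.\<close>

lemma (in real_distribution) measure_Ioc_of_integrable_char: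
  assumes int: "integrable lborel (char M)" and "a \<le> b" "measure M {a} = 0" "measure M {b} = 0"
  shows "complex_of_real (measure M {a<..b}) =
    1 / (2 * pi) * (CLINT x|lborel. indicator {a..b} x *\<^sub>R (CLINT t|lborel. char M t * iexp (x * - t)))"
proof -
  let ?c = "char M"
  let ?k = "\<lambda>t. (iexp (- (t * a)) - iexp (- (t * b))) / (\<i> * t)"
  have k_bound: "norm (?k t) \<le> b - a" if "t \<noteq> 0" for t
  proof -
    have "norm (?k t) = norm (CLINT x|lborel. indicator {a..b} x *\<^sub>R iexp (x * - t))"
      using integral_Icc_iexp[OF \<open>a \<le> b\<close> that] by simp
    also have "\<dots> \<le> (LINT x|lborel. norm (indicator {a..b} x *\<^sub>R iexp (x * - t)))"
      by (rule integral_norm_bound)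
    also have "\<dots> = b - a" using \<open>a \<le> b\<close> by (simp del: of_real_mult of_real_minus mult_minus_right)
    finally show ?thesis .
  qed
  have ne: "AE t in lborel. t \<noteq> (0::real)"
    by (rule AE_lborel_singleton)
  have "(\<lambda>T::nat. CLINT t|lborel. indicator {-real T<..<real T} t *\<^sub>R (?k t * ?c t)) \<longlonglongrightarrow> (CLINT t|lborel. ?k t * ?c t)"
  proof (rule integral_dominated_convergence[where w="\<lambda>t. (b - a) * norm (?c t)"])
    show "AE t in lborel. norm (indicator {-real T<..<real T} t *\<^sub>R (?k t * ?c t)) \<le> (b - a) * norm (?c t)" for T
      using ne
    proof eventually_elim
      case (elim t)
      have "norm (?k t * ?c t) \<le> (b - a) * norm (?c t)"
        unfolding norm_mult by (rule mult_right_mono[OF k_bound[OF elim] norm_ge_zero])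
      then show ?case using \<open>a \<le> b\<close> unfolding norm_scaleR by (cases "t \<in> {-real T<..<real T}") (simp_all only: indicator_simps, simp_all)
    qed
    show "AE t in lborel. (\<lambda>T::nat. indicator {-real T<..<real T} t *\<^sub>R (?k t * ?c t)) \<longlonglongrightarrow> ?k t * ?c t"
    proof (rule AE_I2)
      fix t :: real
      obtain N :: nat where "\<bar>t\<bar> < real N" using reals_Archimedean2 by blast
      then have "\<forall>T\<ge>N. indicator {-real T<..<real T} t *\<^sub>R (?k t * ?c t) = ?k t * ?c t"
        by (auto simp: indicator_def)
      then show "(\<lambda>T::nat. indicator {-real T<..<real T} t *\<^sub>R (?k t * ?c t)) \<longlonglongrightarrow> ?k t * ?c t"
        by (intro tendsto_eventually eventually_sequentiallyI[of N]) blast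
    qed
  qed (use int in auto)
  moreover have "(CLINT t|lborel. indicator {-real T<..<real T} t *\<^sub>R (?k t * ?c t)) = (CLBINT t=-T..T. ?k t * ?c t)" for T :: nat
    by (simp add: interval_lebesgue_integral_def set_lebesgue_integral_def einterval_def greaterThanLessThan_def greaterThan_def lessThan_def Int_def conj_commute)
  ultimately have "(\<lambda>T::nat. 1 / (2 * pi) * (CLBINT t=-T..T. ?k t * ?c t)) \<longlonglongrightarrow> 1 / (2 * pi) * (CLINT t|lborel. ?k t * ?c t)"
    by (intro tendsto_mult tendsto_const) simp
  from LIMSEQ_unique[OF Levy_Inversion[OF assms(2-4)] this]
  have "complex_of_real (measure M {a<..b}) = 1 / (2 * pi) * (CLINT t|lborel. ?k t * ?c t)" .
  also have "(CLINT t|lborel. ?k t * ?c t) = (CLINT t|lborel. CLINT x|lborel. indicator {a..b} x *\<^sub>R (?c t * iexp (x * - t)))"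
  proof (rule integral_cong_AE)
    show "AE t in lborel. ?k t * ?c t = (CLINT x|lborel. indicator {a..b} x *\<^sub>R (?c t * iexp (x * - t)))"
      using ne
    proof eventually_elim
      case (elim t)
      show ?case
        unfolding integral_Icc_iexp[OF \<open>a \<le> b\<close> elim, symmetric] integral_mult_left_zero[symmetric]
        by (simp add: mult.commute)
    qed
  qed auto
  also have "\<dots> = (CLINT x|lborel. CLINT t|lborel. indicator {a..b} x *\<^sub>R (?c t * iexp (x * - t)))"
  proof (rule lborel_pair.Fubini_integral[symmetric], rule lborel_pair.Fubini_integrable)
    show "(\<lambda>(t, x). indicator {a..b} x *\<^sub>R (?c t * iexp (x * - t))) \<in> borel_measurable (lborel \<Otimes>\<^sub>M lborel)"
      by measurable
    show "integrable lborel (\<lambda>t. LINT x|lborel. norm (case (t, x) of (t, x) \<Rightarrow> indicator {a..b} x *\<^sub>R (?c t * iexp (x * - t))))"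
      using int by (simp add: norm_mult del: of_real_mult of_real_minus mult_minus_right)
    show "AE t in lborel. integrable lborel (\<lambda>x. case (t, x) of (t, x) \<Rightarrow> indicator {a..b} x *\<^sub>R (?c t * iexp (x * - t)))"
    proof (rule AE_I2)
      fix t
      have "set_integrable lborel {a..b} (\<lambda>x. ?c t * iexp (x * - t))"
        by (intro borel_integrable_atLeastAtMost' continuous_intros)
      then show "integrable lborel (\<lambda>x. case (t, x) of (t, x) \<Rightarrow> indicator {a..b} x *\<^sub>R (?c t * iexp (x * - t)))"
        by (simp add: set_integrable_def)
    qed
  qed
  finally show ?thesis by (simp del: of_real_mult of_real_minus mult_minus_right)
qed

text \<open>The candidate \<open>p\<close> is continuous and bounded, and inversion gives the mass
  of every interval whose endpoints are not atoms. Such endpoints are dense, so a negative value of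
  \<open>p\<close> would give an interval of negative mass, and the bound on \<open>p\<close>
  excludes atoms altogether. Then the half-open intervals determine the measure.\<close>

lemma (in real_distribution) density_of_integrable_char:
  assumes int: "integrable lborel (char M)"
    and p: "\<And>x. p x = Re (CLINT t|lborel. char M t * iexp (x * - t)) / (2 * pi)"
  shows "M = density lborel (\<lambda>x. ennreal (p x))" "0 \<le> p x"
proof -
  let ?P = "\<lambda>x. CLINT t|lborel. char M t * iexp (x * - t)"
  have contP: "isCont ?P x" for x
    using isCont_integral_iexp[OF int, of uminus] by simp
  have contp: "isCont p x" for x
    unfolding p[abs_def] using continuous_Re[OF contP[of x]] by (intro continuous_divide) simp_all
  have contp_on: "continuous_on S p" for S
    using contp by (simp add: continuous_at_imp_continuous_on)
  have [measurable]: "p \<in> borel_measurable borel"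
    using contp_on by (rule borel_measurable_continuous_onI)
  have intp: "integrable lborel (\<lambda>x. indicator {a..b} x *\<^sub>R p x)" for a b
    using borel_integrable_atLeastAtMost'[OF contp_on[of "{a..b}"]] by (simp add: set_integrable_def)
  define B where "B = (LINT t|lborel. norm (char M t)) / (2 * pi)"
  have bound: "\<bar>p x\<bar> \<le> B" for x
    using norm_integral_iexp_le[of lborel "char M" x uminus] abs_Re_le_cmod[of "?P x"]
    by (simp add: p B_def divide_right_mono del: of_real_mult of_real_minus mult_minus_right)
  have Ioc: "measure M {a<..b} = (LINT x|lborel. indicator {a..b} x *\<^sub>R p x)"
    if "a \<le> b" "measure M {a} = 0" "measure M {b} = 0" for a b
  proof -
    have "integrable lborel (\<lambda>x. indicator {a..b} x *\<^sub>R ?P x)"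
      using borel_integrable_atLeastAtMost'[of a b ?P] contP
      by (simp add: set_integrable_def continuous_at_imp_continuous_on)
    then have I: "Re (CLINT x|lborel. indicator {a..b} x *\<^sub>R ?P x) = (LINT x|lborel. indicator {a..b} x *\<^sub>R Re (?P x))"
      by (subst integral_Re[symmetric]) auto
    have Re_mult: "Re (complex_of_real r * z) = r * Re z" for r z by simp
    have "measure M {a<..b} = Re (complex_of_real (1 / (2 * pi)) * (CLINT x|lborel. indicator {a..b} x *\<^sub>R ?P x))"
      using arg_cong[OF measure_Ioc_of_integrable_char[OF int that], of Re] by simp
    also have "\<dots> = (LINT x|lborel. indicator {a..b} x *\<^sub>R Re (?P x)) / (2 * pi)"
      unfolding Re_mult I by simp
    finally show ?thesis by (simp add: p)
  qed
  have count: "countable {x. measure M {x} \<noteq> 0}" by (rule countable_support)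
  \<comment> \<open>A nonempty open interval is uncountable, while the atoms are countable.\<close>
  have nonatom: "\<exists>y\<in>{u<..<v}. measure M {y} = 0" if "u < v" for u v
    using open_minus_countable[OF count, of "{u<..<v}"] that by fastforce
  have nonneg: "0 \<le> p x" for x
  proof (rule ccontr)
    assume "\<not> 0 \<le> p x"
    then have "p x < p x / 2" "p x < 0" by auto
    from \<open>p x < p x / 2\<close> have "eventually (\<lambda>y. p y < p x / 2) (nhds x)"
      by (rule order_tendstoD(2)[OF contp[of x, unfolded isCont_def tendsto_at_iff_tendsto_nhds]])
    then obtain d where d: "d > 0" "\<And>y. dist y x < d \<Longrightarrow> p y < p x / 2"
      unfolding eventually_nhds_metric by blast
    obtain a where a: "a \<in> {x-d<..<x}" "measure M {a} = 0" using nonatom[of "x-d" x] d by auto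
    obtain b where b: "b \<in> {x<..<x+d}" "measure M {b} = 0" using nonatom[of x "x+d"] d by auto
    have "(LINT x|lborel. indicator {a..b} x *\<^sub>R p x) \<le> (LINT y|lborel. indicator {a..b} y *\<^sub>R (p x / 2))"
    proof (rule integral_mono[OF intp])
      have "p y \<le> p x / 2" if "y \<in> {a..b}" for y
        by (rule less_imp_le[OF d(2)]) (use that a b in \<open>auto simp: dist_real_def\<close>)
      then show "indicator {a..b} y *\<^sub>R p y \<le> indicator {a..b} y *\<^sub>R (p x / 2)" for y
        by (auto simp: indicator_def)
    qed (intro integrable_scaleR_left integrable_real_indicator, use a b in auto)
    also have "\<dots> = (b - a) * (p x / 2)" using a b by simp
    also have "\<dots> < 0" using a b \<open>p x < 0\<close> by (simp add: mult_pos_neg)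
    finally show False using Ioc[of a b] a b measure_nonneg[of M "{a<..b}"] by simp
  qed
  then show "0 \<le> p x" .
  have noatom: "measure M {x} = 0" for x
  proof (rule ccontr)
    assume ne: "measure M {x} \<noteq> 0"
    \<comment> \<open>An interval around \<open>x\<close> of length at most \<open>2 * d\<close> has
      mass at most \<open>2 * d * B\<close>, which is the fraction \<open>B / (B + 1)\<close> of the
      mass of \<open>x\<close> itself. The shift by 1 keeps the quotient meaningful for
      \<open>B = 0\<close>.\<close>
    define d where "d = measure M {x} / (2 * (B + 1))"
    have B0: "0 \<le> B" using bound[of 0] by linarith
    then have d: "d > 0" using ne by (simp add: d_def zero_less_measure_iff)
    obtain a where a: "a \<in> {x-d<..<x}" "measure M {a} = 0" using nonatom[of "x-d" x] d by auto
    obtain b where b: "b \<in> {x<..<x+d}" "measure M {b} = 0" using nonatom[of x "x+d"] d by auto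
    have "measure M {x} \<le> measure M {a<..b}" using a b by (intro finite_measure_mono) auto
    also have "\<dots> = (LINT x|lborel. indicator {a..b} x *\<^sub>R p x)" using Ioc a b by auto
    also have "\<dots> \<le> (LINT y|lborel. indicator {a..b} y *\<^sub>R B)"
    proof (rule integral_mono[OF intp])
      show "indicator {a..b} y *\<^sub>R p y \<le> indicator {a..b} y *\<^sub>R B" for y
        using bound[of y] by (simp add: indicator_def abs_le_iff)
    qed (intro integrable_scaleR_left integrable_real_indicator, use a b in auto)
    also have "\<dots> = (b - a) * B" using a b by simp
    also have "\<dots> \<le> 2 * d * B" using a b B0 by (intro mult_right_mono) auto
    also have "2 * d = measure M {x} / (B + 1)" using B0 by (simp add: d_def field_simps)
    also have "measure M {x} / (B + 1) * B = measure M {x} * (B / (B + 1))" by simp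
    also have "\<dots> < measure M {x} * 1" using B0 ne
      by (intro mult_strict_left_mono) (auto simp: zero_less_measure_iff)
    finally show False by simp
  qed
  let ?N = "density lborel (\<lambda>x. ennreal (p x))"
  show "M = ?N"
  proof (rule measure_eqI_generator_eq[where \<Omega>=UNIV])
    fix X assume "X \<in> range (\<lambda>(a, b). {a<..b::real})"
    then obtain a b where X: "X = {a<..b}" by auto
    show "emeasure M X = emeasure ?N X"
    proof (cases "a \<le> b")
      case True
      have "emeasure M X = ennreal (LINT x|lborel. indicator {a..b} x *\<^sub>R p x)"
        by (simp add: X emeasure_eq_measure Ioc[OF True noatom noatom])
      also have "\<dots> = (\<integral>\<^sup>+x. ennreal (indicator {a..b} x *\<^sub>R p x) \<partial>lborel)"
        by (rule nn_integral_eq_integral[symmetric]) (auto simp: intp[simplified] nonneg)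
      also have "\<dots> = (\<integral>\<^sup>+x. ennreal (p x) * indicator X x \<partial>lborel)"
        using AE_lborel_singleton[of a]
        by (intro nn_integral_cong_AE) (auto elim!: eventually_mono simp: X indicator_def)
      finally show ?thesis by (simp add: emeasure_density X)
    qed (simp add: X)
  next
    show "(\<Union>i. {- real (i::nat)<..real i}) = UNIV" by (rule UN_Ioc_eq_UNIV)
  qed (auto simp: borel_sigma_sets_Ioc Int_stable_def emeasure_eq_measure)
qed

subsection \<open>Smooth densities\<close>

text \<open>Taylor expansion at distance \<open>h = - p'(x) / (A + |p'(x)|)\<close>, which lies in \<open>[-1, 1]\<close>.\<close>

lemma deriv_square_div_le:
  fixes p p' p'' :: "real \<Rightarrow> real"
  assumes nonneg: "\<And>y. 0 \<le> p y"
    and D: "\<And>y. (p has_real_derivative p' y) (at y)" "\<And>y. (p' has_real_derivative p'' y) (at y)"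
    and A: "\<And>y. \<bar>y - x\<bar> \<le> 1 \<Longrightarrow> \<bar>p'' y\<bar> \<le> A" and "0 < p x"
  shows "(p' x)\<^sup>2 / p x \<le> 2 * (A + \<bar>p' x\<bar>)"
proof (cases "p' x = 0")
  case False
  define s where "s = A + \<bar>p' x\<bar>"
  have A0: "0 \<le> A" using A[of x] by simp
  have s: "s > 0" "A \<le> s" "\<bar>p' x\<bar> \<le> s" using False A0 by (auto simp: s_def)
  define h where "h = - p' x / s"
  have h: "\<bar>h\<bar> \<le> 1" "h \<noteq> 0" using s False by (auto simp: h_def)
  define diff where "diff m = (if m = 0 then p else if m = Suc 0 then p' else p'')" for m :: nat
  have "\<exists>t. (if x + h < x then x + h < t \<and> t < x else x < t \<and> t < x + h) \<and>
      p (x + h) = (\<Sum>m<2. diff m x / fact m * ((x + h) - x) ^ m) + diff 2 t / fact 2 * ((x + h) - x) ^ 2"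
    by (rule Taylor[where a="x-1" and b="x+1"]) (use h D in \<open>auto simp: diff_def less_2_cases_iff\<close>)
  then obtain t where t': "if x + h < x then x + h < t \<and> t < x else x < t \<and> t < x + h"
    and "p (x + h) = (\<Sum>m<2. diff m x / fact m * ((x + h) - x) ^ m) + diff 2 t / fact 2 * ((x + h) - x) ^ 2"
    by blast
  then have t: "\<bar>t - x\<bar> \<le> 1" "p (x + h) = p x + p' x * h + p'' t / 2 * h\<^sup>2"
    using h by (auto simp: diff_def numeral_2_eq_2 split: if_splits)
  have "p'' t / 2 * h\<^sup>2 \<le> s / 2 * h\<^sup>2"
    using A[OF t(1)] s by (intro mult_right_mono) auto
  \<comment> \<open>The value at \<open>x + h\<close> is nonnegative; inserting
    \<open>h = - p' x / s\<close> turns this into the required lower bound for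
    \<open>p x\<close>.\<close>
  then have "0 \<le> p x + p' x * h + s / 2 * h\<^sup>2" using nonneg[of "x + h"] t(2) by linarith
  also have "\<dots> = p x - (p' x)\<^sup>2 / (2 * s)"
    using s by (simp add: h_def field_simps power2_eq_square)
  finally have "(p' x)\<^sup>2 \<le> 2 * s * p x" using s by (simp add: field_simps)
  then show ?thesis using \<open>0 < p x\<close> by (simp add: s_def field_simps)
qed (use A[of x] in simp)

text \<open>Differentiating the inversion integral in \<open>x\<close> multiplies the integrand by
  \<open>- \<i> * t\<close>. Decay of order \<open>(1 + t^2)^(-2)\<close> leaves room for the
  weights \<open>t\<close> and \<open>t^2\<close> belonging to \<open>p'\<close> and
  \<open>p''\<close>: the weighted functions and their first two derivatives are still
  \<open>O(1 / (1 + t^2))\<close>, so their transforms decay in \<open>x\<close>.\<close>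

lemma (in real_distribution) smooth_density_of_char:
  fixes G1 G2 :: "real \<Rightarrow> complex"
  assumes D: "\<And>t. (char M has_vector_derivative G1 t) (at t)" "\<And>t. (G1 has_vector_derivative G2 t) (at t)"
    and C: "\<And>t. isCont G2 t"
    and B: "\<And>t. norm (char M t) \<le> K / (1 + t\<^sup>2)\<^sup>2" "\<And>t. norm (G1 t) \<le> K / (1 + t\<^sup>2)\<^sup>2"
      "\<And>t. norm (G2 t) \<le> K / (1 + t\<^sup>2)\<^sup>2"
  obtains p p' p'' :: "real \<Rightarrow> real" and c where
    "\<And>x. 0 \<le> p x" "M = density lborel (\<lambda>x. ennreal (p x))"
    "\<And>x. (p has_real_derivative p' x) (at x)" "\<And>x. (p' has_real_derivative p'' x) (at x)"
    "\<And>x. \<bar>p' x\<bar> \<le> c / (1 + x\<^sup>2)" "\<And>x. \<bar>p'' x\<bar> \<le> c / (1 + x\<^sup>2)"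
proof -
  let ?G = "char M"
  have CG: "isCont ?G t" "isCont G1 t" for t using D has_vector_derivative_continuous by blast+
  \<comment> \<open>One of the two factors \<open>1 + t^2\<close> of the decay is spent on the
    polynomial weight \<open>w\<close>.\<close>
  have weight: "\<bar>w\<bar> * norm z \<le> K / (1 + t\<^sup>2)" if "\<bar>w\<bar> \<le> 1 + t\<^sup>2" "norm z \<le> K / (1 + t\<^sup>2)\<^sup>2" for w t and z :: complex
  proof -
    have "\<bar>w\<bar> * norm z \<le> (1 + t\<^sup>2) * (K / (1 + t\<^sup>2)\<^sup>2)"
      using that by (intro mult_mono) auto
    also have "\<dots> = K / (1 + t\<^sup>2)" by (simp add: power2_eq_square add_pos_nonneg)
    finally show ?thesis .
  qed
  have abs_le: "\<bar>t\<bar> \<le> 1 + t\<^sup>2" for t :: real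
    using sum_squares_bound[of "\<bar>t\<bar>" 1] by (simp add: power2_eq_square)
  note w0 = weight[of 1, simplified] and w1 = weight[OF abs_le]
  have w2: "t\<^sup>2 * norm z \<le> K / (1 + t\<^sup>2)" if "norm z \<le> K / (1 + t\<^sup>2)\<^sup>2" for t and z :: complex
    using weight[of "t\<^sup>2" t z] that by simp
  have K0: "0 \<le> K / (1 + t\<^sup>2)" for t using order_trans[OF norm_ge_zero w0[OF B(1)]] .
  \<comment> \<open>\<open>E\<close> and \<open>H\<close> are the integrands behind
    \<open>p'\<close> and \<open>p''\<close>; the suffixes 1 and 2 denote their derivatives in
    \<open>t\<close>.\<close>
  define E where "E t = - \<i> * (t * ?G t)" for t :: real
  define E1 where "E1 t = - \<i> * (?G t + t * G1 t)" for t :: real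
  define E2 where "E2 t = - \<i> * (2 * G1 t + t * G2 t)" for t :: real
  define H where "H t = - (t\<^sup>2 * ?G t)" for t :: real
  define H1 where "H1 t = - (2 * (t * ?G t) + t\<^sup>2 * G1 t)" for t :: real
  define H2 where "H2 t = - (2 * ?G t + 4 * (t * G1 t) + t\<^sup>2 * G2 t)" for t :: real
  have DE: "(E has_vector_derivative E1 t) (at t)" "(E1 has_vector_derivative E2 t) (at t)" for t
    unfolding E_def[abs_def] E1_def[abs_def] E2_def
    by (rule derivative_eq_intros has_vector_derivative_real_field D refl | simp add: algebra_simps)+
  have DH: "(H has_vector_derivative H1 t) (at t)" "(H1 has_vector_derivative H2 t) (at t)" for t
    unfolding H_def[abs_def] H1_def[abs_def] H2_def
    by (rule derivative_eq_intros has_vector_derivative_real_field D refl | simp add: algebra_simps)+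
  have CE: "isCont E t" "isCont E2 t" "isCont H t" "isCont H2 t" for t
    unfolding E_def[abs_def] E2_def[abs_def] H_def[abs_def] H2_def[abs_def]
    by (intro continuous_intros C CG)+
  \<comment> \<open>The common constant is \<open>7 = 2 + 4 + 1\<close>, the sum of the coefficients
    in \<open>H2\<close>, which is the largest of the six sums.\<close>
  have BE: "norm (E t) \<le> 7 * K / (1 + t\<^sup>2)" "norm (E1 t) \<le> 7 * K / (1 + t\<^sup>2)" "norm (E2 t) \<le> 7 * K / (1 + t\<^sup>2)" for t
  proof -
    show "norm (E t) \<le> 7 * K / (1 + t\<^sup>2)"
      using w1[OF B(1)[of t]] K0[of t] by (simp add: E_def norm_mult)
    have "norm (E1 t) \<le> norm (?G t) + \<bar>t\<bar> * norm (G1 t)"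
      unfolding E1_def by (simp add: norm_mult) (rule order_trans[OF norm_triangle_ineq], simp add: norm_mult)
    then show "norm (E1 t) \<le> 7 * K / (1 + t\<^sup>2)"
      using w0[OF B(1)[of t]] w1[OF B(2)[of t]] K0[of t] by simp
    have "norm (E2 t) \<le> 2 * norm (G1 t) + \<bar>t\<bar> * norm (G2 t)"
      unfolding E2_def by (simp add: norm_mult) (rule order_trans[OF norm_triangle_ineq], simp add: norm_mult)
    then show "norm (E2 t) \<le> 7 * K / (1 + t\<^sup>2)"
      using w0[OF B(2)[of t]] w1[OF B(3)[of t]] K0[of t] by simp
  qed
  have BH: "norm (H t) \<le> 7 * K / (1 + t\<^sup>2)" "norm (H1 t) \<le> 7 * K / (1 + t\<^sup>2)" "norm (H2 t) \<le> 7 * K / (1 + t\<^sup>2)" for t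
  proof -
    show "norm (H t) \<le> 7 * K / (1 + t\<^sup>2)"
      using w2[OF B(1)[of t]] K0[of t] by (simp add: H_def norm_mult norm_power)
    have "norm (H1 t) \<le> 2 * (\<bar>t\<bar> * norm (?G t)) + t\<^sup>2 * norm (G1 t)"
      unfolding H1_def norm_minus_cancel by (rule order_trans[OF norm_triangle_ineq]) (simp add: norm_mult norm_power)
    then show "norm (H1 t) \<le> 7 * K / (1 + t\<^sup>2)"
      using w1[OF B(1)[of t]] w2[OF B(2)[of t]] K0[of t] by simp
    have "norm (H2 t) \<le> 2 * norm (?G t) + 4 * (\<bar>t\<bar> * norm (G1 t)) + t\<^sup>2 * norm (G2 t)"
      unfolding H2_def norm_minus_cancel
      by (rule order_trans[OF norm_triangle_ineq] add_mono)+ (simp_all add: norm_mult norm_power)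
    then show "norm (H2 t) \<le> 7 * K / (1 + t\<^sup>2)"
      using w0[OF B(1)[of t]] w1[OF B(2)[of t]] w2[OF B(3)[of t]] K0[of t] by simp
  qed
  have int: "integrable lborel F" if "\<And>t. isCont F t" "\<And>t. norm (F t) \<le> k / (1 + t\<^sup>2)" for F :: "real \<Rightarrow> complex" and k
    using that by (auto intro!: integrable_of_norm_le_1_plus_square borel_measurable_continuous_onI continuous_at_imp_continuous_on)
  have intG: "integrable lborel ?G" using int[OF CG(1), of K] w0[OF B(1)] by simp
  have intE: "integrable lborel E" using int[OF CE(1) BE(1)] .
  have intH: "integrable lborel H" using int[OF CE(3) BH(1)] .
  let ?I = "\<lambda>F x. CLINT t|lborel. F t * iexp (x * - t)"
  have E_eq: "\<i> * (complex_of_real (- t) * ?G t) = E t" "complex_of_real (- t) * ?G t = - \<i> * E t" for t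
    by (simp_all add: E_def)
  have H_eq: "\<i> * (complex_of_real (- t) * E t) = H t" "complex_of_real (- t) * E t = - \<i> * H t" for t
    by (simp_all add: E_def H_def power2_eq_square mult_ac)
  have P: "((\<lambda>x. ?I ?G x) has_vector_derivative ?I E x) (at x)" for x
    using has_vector_derivative_integral_iexp[OF intG, of uminus x] integrable_mult_right[OF intE, of "- \<i>"]
    unfolding E_eq by simp
  have P': "((\<lambda>x. ?I E x) has_vector_derivative ?I H x) (at x)" for x
    using has_vector_derivative_integral_iexp[OF intE, of uminus x] integrable_mult_right[OF intH, of "- \<i>"]
    unfolding H_eq by simp
  \<comment> \<open>The real part and the factor \<open>1 / (2 * pi)\<close> turn inversion
    integrals into the density \<open>R ?G\<close> and its derivatives \<open>R E\<close> and
    \<open>R H\<close>.\<close>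
  define R where "R F x = Re (?I F x) / (2 * pi)" for F x
  have DR: "(R F has_real_derivative R F' x) (at x)" if "((\<lambda>x. ?I F x) has_vector_derivative ?I F' x) (at x)" for F F' x
    unfolding R_def[abs_def] has_real_derivative_iff_has_vector_derivative
    using has_vector_derivative_divide[OF bounded_linear.has_vector_derivative[OF bounded_linear_Re that]] .
  define c where "c = 2 * (7 * K) * (LINT t|lborel. 1 / (1 + t\<^sup>2)) / (2 * pi)"
  have BR: "\<bar>R F x\<bar> \<le> c / (1 + x\<^sup>2)" if "norm (?I F x) \<le> 2 * (7 * K) * (LINT t|lborel. 1 / (1 + t\<^sup>2)) / (1 + x\<^sup>2)" for F x
  proof -
    have "\<bar>R F x\<bar> \<le> norm (?I F x) / (2 * pi)"
      unfolding R_def using abs_Re_le_cmod[of "?I F x"] by (simp add: divide_right_mono)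
    also have "\<dots> \<le> 2 * (7 * K) * (LINT t|lborel. 1 / (1 + t\<^sup>2)) / (1 + x\<^sup>2) / (2 * pi)"
      using that by (intro divide_right_mono) auto
    finally show ?thesis
      unfolding c_def by (simp only: divide_divide_eq_left mult.commute[of "1 + x\<^sup>2"])
  qed
  show thesis
  proof (rule that[of "R ?G" "R E" "R H" c])
    show "0 \<le> R ?G x" "M = density lborel (\<lambda>x. ennreal (R ?G x))" for x
      using density_of_integrable_char[OF intG, of "R ?G"] by (simp_all add: R_def)
  qed (auto intro!: DR P P' BR fourier_decay[OF DE CE(2) BE] fourier_decay[OF DH CE(4) BH])
qed

section \<open>Derivatives of characteristic functions and of their powers\<close>

text \<open>The second moment allows two differentiations under the integral sign; the first two
  absolute moments bound the results uniformly in \<open>t\<close>.\<close>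

lemma (in real_distribution) char_has_derivatives:
  assumes "integrable M (\<lambda>x. x\<^sup>2)"
  obtains f' f'' :: "real \<Rightarrow> complex" and L where
    "\<And>t. (char M has_vector_derivative f' t) (at t)" "\<And>t. (f' has_vector_derivative f'' t) (at t)"
    "\<And>t. isCont f'' t" "\<And>t. norm (f' t) \<le> L" "\<And>t. norm (f'' t) \<le> L"
proof -
  have int1: "integrable M (\<lambda>x. x)"
    using square_integrable_imp_integrable[of "\<lambda>x. x"] assms by simp
  \<comment> \<open>The factor 1 is the weight \<open>g\<close> for which the characteristic
    function is an instance of the general integral; keeping it lets the differentiation lemma apply
    literally.\<close>
  have i1: "integrable M (\<lambda>x. \<i> * (complex_of_real x * 1))"
    by (intro integrable_mult_right integrable_mult_left integrable_of_real int1)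
  have i1': "integrable M (\<lambda>x. complex_of_real x * 1)"
    by (intro integrable_mult_left integrable_of_real int1)
  have i2': "integrable M (\<lambda>x. complex_of_real x * (\<i> * (complex_of_real x * 1)))"
  proof -
    have "integrable M (\<lambda>x. \<i> * complex_of_real (x\<^sup>2))"
      by (intro integrable_mult_right integrable_of_real assms)
    then show ?thesis by (simp add: power2_eq_square mult_ac)
  qed
  then have i2: "integrable M (\<lambda>x. \<i> * (complex_of_real x * (\<i> * (complex_of_real x * 1))))"
    by (rule integrable_mult_right)
  have m: "(\<lambda>x. x) \<in> borel_measurable M" by simp
  let ?f1 = "\<lambda>t. CLINT x|M. (\<i> * (complex_of_real x * 1)) * iexp (t * x)"
  let ?f2 = "\<lambda>t. CLINT x|M. (\<i> * (complex_of_real x * (\<i> * (complex_of_real x * 1)))) * iexp (t * x)"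
  have char_eq: "char M = (\<lambda>t. CLINT x|M. 1 * iexp (t * x))" by (simp add: char_def fun_eq_iff)
  show thesis
  proof (rule that[of ?f1 ?f2])
    show "(char M has_vector_derivative ?f1 t) (at t)" for t
      unfolding char_eq by (rule has_vector_derivative_integral_iexp[OF _ m i1']) simp
    show "(?f1 has_vector_derivative ?f2 t) (at t)" for t
      by (rule has_vector_derivative_integral_iexp[OF i1 m i2'])
    show "isCont ?f2 t" for t by (rule isCont_integral_iexp[OF i2 m])
    show "norm (?f1 t) \<le> max (LINT x|M. norm (\<i> * (complex_of_real x * 1))) (LINT x|M. norm (\<i> * (complex_of_real x * (\<i> * (complex_of_real x * 1)))))" for t
      by (rule max.coboundedI1[OF norm_integral_iexp_le])
    show "norm (?f2 t) \<le> max (LINT x|M. norm (\<i> * (complex_of_real x * 1))) (LINT x|M. norm (\<i> * (complex_of_real x * (\<i> * (complex_of_real x * 1)))))" for t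
      by (rule max.coboundedI2[OF norm_integral_iexp_le])
  qed
qed

text \<open>Two derivatives of the power \<open>m + 2\<close> consume at most two factors of
  \<open>char N t\<close>. Every resulting term keeps at least \<open>m\<close> factors, which decay
  by assumption, while the derivatives of \<open>char N\<close> are bounded.\<close>

lemma (in real_distribution) smooth_density_of_char_power:
  assumes N: "real_distribution N" "integrable N (\<lambda>x. x\<^sup>2)"
    and char_eq: "\<And>t. char M t = char N t ^ (m + 2)"
    and decay: "\<And>t. norm (char N t) ^ m \<le> D / (1 + t\<^sup>2)\<^sup>2"
  obtains p p' p'' :: "real \<Rightarrow> real" and c where
    "\<And>x. 0 \<le> p x" "M = density lborel (\<lambda>x. ennreal (p x))"
    "\<And>x. (p has_real_derivative p' x) (at x)" "\<And>x. (p' has_real_derivative p'' x) (at x)"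
    "\<And>x. \<bar>p' x\<bar> \<le> c / (1 + x\<^sup>2)" "\<And>x. \<bar>p'' x\<bar> \<le> c / (1 + x\<^sup>2)"
proof -
  interpret N: real_distribution N by fact
  obtain f' f'' L where f: "\<And>t. (char N has_vector_derivative f' t) (at t)" "\<And>t. (f' has_vector_derivative f'' t) (at t)"
    "\<And>t. isCont f'' t" and L: "\<And>t. norm (f' t) \<le> L" "\<And>t. norm (f'' t) \<le> L"
    using N.char_has_derivatives[OF N(2)] by blast
  let ?f = "char N"
  have L0: "0 \<le> L" using order_trans[OF norm_ge_zero L(1)] .
  have D0: "0 \<le> D" using order_trans[OF _ decay[of 0]] by simp
  have Cf: "isCont f' t" for t using f has_vector_derivative_continuous by blast
  define g1 where "g1 t = of_nat (m + 2) * (?f t ^ (m + 1) * f' t)" for t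
  define g2 where "g2 t = of_nat (m + 2) * (of_nat (m + 1) * (?f t ^ m * f' t ^ 2) + ?f t ^ (m + 1) * f'' t)" for t
  have pow: "((\<lambda>t. ?f t ^ Suc k) has_vector_derivative of_nat (Suc k) * (?f t ^ k * f' t)) (at t)" for k t
  proof (induction k)
    case (Suc k)
    show ?case
      using has_vector_derivative_mult[OF f(1)[of t] Suc] by (simp add: algebra_simps)
  qed (use f in auto)
  have d1: "(char M has_vector_derivative g1 t) (at t)" for t
    using pow[of "m + 1" t] unfolding char_eq[abs_def] g1_def by simp
  have d2: "(g1 has_vector_derivative g2 t) (at t)" for t
    unfolding g1_def[abs_def]
    by (rule has_vector_derivative_eq_rhs[OF has_vector_derivative_mult_right[OF has_vector_derivative_mult[OF pow[of m, simplified Suc_eq_plus1] f(2)]]])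
       (simp add: g2_def power2_eq_square algebra_simps)
  have c2: "isCont g2 t" for t
    unfolding g2_def[abs_def] by (intro continuous_intros Cf f N.isCont_char)
  \<comment> \<open>The three summands bound, in order, the two terms of \<open>g2\<close> (the
    second one also bounds \<open>g1\<close>) and the power itself.\<close>
  define K where "K = real (m + 2) * (real (m + 1) * (1 + L)\<^sup>2) * D + real (m + 2) * (1 + L) * D + D"
  have f1: "norm (?f t) \<le> 1" for t by (rule N.cmod_char_le_1)
  have pow_le: "norm (?f t) ^ (m + k) \<le> D / (1 + t\<^sup>2)\<^sup>2" for k t
  proof -
    have "norm (?f t) ^ (m + k) \<le> norm (?f t) ^ m" using f1 by (intro power_decreasing) auto
    then show ?thesis using decay order_trans by blast
  qed
  show thesis
  proof (rule smooth_density_of_char[OF d1 d2 c2, of K])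
    fix t
    let ?w = "D / (1 + t\<^sup>2)\<^sup>2"
    have w: "0 \<le> ?w" using D0 by simp
    have K: "K / (1 + t\<^sup>2)\<^sup>2 = real (m + 2) * (real (m + 1) * (?w * (1 + L)\<^sup>2)) + real (m + 2) * (?w * (1 + L)) + ?w"
      unfolding K_def by (simp add: add_divide_distrib mult_ac)
    have *: "0 \<le> real (m + 2) * (real (m + 1) * (?w * (1 + L)\<^sup>2))" "0 \<le> real (m + 2) * (?w * (1 + L))"
      using L0 by (intro mult_nonneg_nonneg w; simp)+
    show "norm (char M t) \<le> K / (1 + t\<^sup>2)\<^sup>2"
      using pow_le[of t 2] * unfolding K char_eq norm_power by linarith
    have a: "norm (?f t) ^ (m + 1) * norm (f' t) \<le> ?w * (1 + L)"
      using L(1)[of t] L0 by (intro mult_mono pow_le w) auto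
    have "norm (g1 t) = real (m + 2) * (norm (?f t) ^ (m + 1) * norm (f' t))"
      by (simp only: g1_def norm_mult norm_power norm_of_nat)
    also have "\<dots> \<le> real (m + 2) * (?w * (1 + L))" by (rule mult_left_mono[OF a]) simp
    finally show "norm (g1 t) \<le> K / (1 + t\<^sup>2)\<^sup>2" using * w unfolding K by linarith
    have b: "norm (?f t) ^ (m + 1) * norm (f'' t) \<le> ?w * (1 + L)"
      using L(2)[of t] L0 by (intro mult_mono pow_le w) auto
    have c: "norm (?f t) ^ m * norm (f' t) ^ 2 \<le> ?w * (1 + L)^2"
      using L(1)[of t] L0 pow_le[of t 0] by (intro mult_mono power_mono w) auto
    have "norm (g2 t) \<le> real (m + 2) * (real (m + 1) * (norm (?f t) ^ m * norm (f' t) ^ 2) + norm (?f t) ^ (m + 1) * norm (f'' t))"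
      unfolding g2_def norm_mult norm_of_nat
      by (intro mult_left_mono order_trans[OF norm_triangle_ineq]) (simp_all only: norm_mult norm_power norm_of_nat of_nat_0_le_iff order_refl)
    also have "\<dots> \<le> real (m + 2) * (real (m + 1) * (?w * (1 + L)^2) + ?w * (1 + L))"
      by (intro mult_left_mono add_mono b c) auto
    finally show "norm (g2 t) \<le> K / (1 + t\<^sup>2)\<^sup>2" using w unfolding K distrib_left by linarith
  qed (rule that)
qed

section \<open>From decaying derivatives to finite Fisher information\<close>

text \<open>By the mean value theorem \<open>p\<close> is Lipschitz with constant \<open>c\<close>.
  The choice of \<open>e / (c + 1)\<close> below also covers \<open>c = 0\<close>.\<close>

lemma loc_abs_cont_of_bounded_deriv:
  assumes D: "\<And>x. (p has_real_derivative p' x) (at x)" and B: "\<And>x. \<bar>p' x\<bar> \<le> c"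
  shows "loc_abs_cont p"
  unfolding loc_abs_cont_def
proof (intro allI impI)
  fix a b e :: real assume "e > 0"
  have c0: "0 \<le> c" using order_trans[OF abs_ge_zero B] .
  have lip: "\<bar>p v - p u\<bar> \<le> c * (v - u)" if uv: "u < v" for u v
  proof -
    obtain z where "p v - p u = (v - u) * p' z"
      using MVT2[OF uv D] by blast
    then show ?thesis using B[of z] uv by (simp add: abs_mult mult.commute mult_right_mono)
  qed
  show "\<exists>d>0. \<forall>(n::nat) (u::nat \<Rightarrow> real) v.
        (\<forall>k<n. a \<le> u k \<and> u k < v k \<and> v k \<le> b) \<and>
        (\<forall>k<n. \<forall>j<n. k \<noteq> j \<longrightarrow> v k \<le> u j \<or> v j \<le> u k) \<and>
        (\<Sum>k<n. v k - u k) < d \<longrightarrow>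
        (\<Sum>k<n. \<bar>p (v k) - p (u k)\<bar>) < e"
  proof (intro exI[of _ "e / (c + 1)"] conjI allI impI; (elim conjE)?)
    show "0 < e / (c + 1)" using \<open>e > 0\<close> c0 by simp
    fix n :: nat and u v :: "nat \<Rightarrow> real"
    assume uv: "\<forall>k<n. a \<le> u k \<and> u k < v k \<and> v k \<le> b" and s: "(\<Sum>k<n. v k - u k) < e / (c + 1)"
    have "(\<Sum>k<n. \<bar>p (v k) - p (u k)\<bar>) \<le> (\<Sum>k<n. c * (v k - u k))"
      using uv lip by (intro sum_mono) auto
    also have "\<dots> \<le> (c + 1) * (\<Sum>k<n. v k - u k)"
      unfolding sum_distrib_left[symmetric] using uv by (intro mult_right_mono sum_nonneg) (auto simp: less_imp_le)
    also have "\<dots> < e" using s c0 by (simp add: field_simps)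
    finally show "(\<Sum>k<n. \<bar>p (v k) - p (u k)\<bar>) < e" .
  qed
qed

text \<open>Over a unit neighbourhood of \<open>x\<close> the bound on \<open>p''\<close> grows by
  at most the factor 3, so the pointwise estimate of \<open>p'^2 / p\<close> gives
  \<open>2 * (3 * c + c) / (1 + x^2)\<close>, which is integrable.\<close>

lemma fisher_integral_finite:
  fixes p p' p'' :: "real \<Rightarrow> real"
  assumes nonneg: "\<And>x. 0 \<le> p x"
    and D: "\<And>x. (p has_real_derivative p' x) (at x)" "\<And>x. (p' has_real_derivative p'' x) (at x)"
    and B: "\<And>x. \<bar>p' x\<bar> \<le> c / (1 + x\<^sup>2)" "\<And>x. \<bar>p'' x\<bar> \<le> c / (1 + x\<^sup>2)"
  shows "(\<integral>\<^sup>+ x. indicator {x. 0 < p x} x * ennreal ((p' x)\<^sup>2 / p x) \<partial>lborel) < \<infinity>"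
proof -
  have c0: "0 \<le> c" using order_trans[OF abs_ge_zero B(1)[of 0]] by simp
  have "(\<integral>\<^sup>+ x. indicator {x. 0 < p x} x * ennreal ((p' x)\<^sup>2 / p x) \<partial>lborel)
      \<le> (\<integral>\<^sup>+ x. ennreal (8 * c * (1 / (1 + x\<^sup>2))) \<partial>lborel)"
  proof (rule nn_integral_mono)
    fix x
    have loc: "\<bar>p'' y\<bar> \<le> 3 * c / (1 + x\<^sup>2)" if "\<bar>y - x\<bar> \<le> 1" for y
    proof -
      \<comment> \<open>The difference of the two sides is the square of
        \<open>2 * y - x\<close>.\<close>
      have "x\<^sup>2 \<le> 2 * y\<^sup>2 + 2 * (y - x)\<^sup>2"
        using sum_squares_ge_zero[of "2 * y - x" 0] by (simp add: power2_eq_square algebra_simps)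
      moreover have "(y - x)\<^sup>2 \<le> 1" using that by (simp add: abs_square_le_1)
      ultimately have "1 + x\<^sup>2 \<le> 3 * (1 + y\<^sup>2)" by simp (smt (verit) zero_le_power2)
      then have "1 / (1 + y\<^sup>2) \<le> 3 / (1 + x\<^sup>2)"
        by (simp add: divide_simps add_pos_nonneg)
      then have "c * (1 / (1 + y\<^sup>2)) \<le> c * (3 / (1 + x\<^sup>2))" by (rule mult_left_mono[OF _ c0])
      then show ?thesis using B(2)[of y] by (simp add: mult_ac)
    qed
    have "(p' x)\<^sup>2 / p x \<le> 8 * c * (1 / (1 + x\<^sup>2))" if "0 < p x"
    proof -
      have "(p' x)\<^sup>2 / p x \<le> 2 * (3 * c / (1 + x\<^sup>2) + \<bar>p' x\<bar>)"
        by (rule deriv_square_div_le[OF nonneg D loc that])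
      also have "\<dots> \<le> 2 * (3 * c / (1 + x\<^sup>2) + c / (1 + x\<^sup>2))" using B(1)[of x] by simp
      also have "\<dots> = 8 * c * (1 / (1 + x\<^sup>2))" by simp
      finally show ?thesis .
    qed
    then show "indicator {x. 0 < p x} x * ennreal ((p' x)\<^sup>2 / p x) \<le> ennreal (8 * c * (1 / (1 + x\<^sup>2)))"
      by (auto simp: indicator_def intro!: ennreal_leI)
  qed
  also have "\<dots> = ennreal (LINT x|lborel. 8 * c * (1 / (1 + x\<^sup>2)))"
    using c0 by (intro nn_integral_eq_integral integrable_mult_right integrable_inverse_1_plus_square_lborel) auto
  finally show ?thesis by (simp add: le_less_trans[OF _ ennreal_less_top])
qed

section \<open>Polynomial decay of high powers\<close>

text \<open>For large \<open>t\<close> the power is \<open>O(t^(-4))\<close>, since the exponent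
  \<open>m * \<epsilon>\<close> is at least 4. The remaining bounded range is absorbed by the
  constant because the modulus is at most 1, and symmetry handles negative \<open>t\<close>.\<close>

lemma char_power_decay:
  fixes f :: "real \<Rightarrow> complex"
  assumes O: "(\<lambda>t. cmod (f t)) \<in> O[at_top](\<lambda>t. t powr (- \<epsilon>))" and "\<epsilon> > 0"
    and le1: "\<And>t. cmod (f t) \<le> 1" and sym: "\<And>t. cmod (f (- t)) = cmod (f t)" and m: "4 \<le> real m * \<epsilon>"
  obtains D where "\<And>t. cmod (f t) ^ m \<le> D / (1 + t\<^sup>2)\<^sup>2"
proof -
  obtain C T where C: "C > 0" and T: "\<And>t. t \<ge> T \<Longrightarrow> cmod (f t) \<le> C * t powr (- \<epsilon>)"
    using O by (elim landau_o.bigE) (auto simp: eventually_at_top_linorder)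
  define S where "S = max 1 T"
  have S: "S \<ge> 1" "S \<ge> T" by (auto simp: S_def)
  \<comment> \<open>The first summand serves \<open>t \<ge> S\<close>, with 4 coming from
    \<open>1 + t^2 \<le> 2 * t^2\<close>; the second serves the range below
    \<open>S\<close>.\<close>
  define D where "D = 4 * C ^ m + (1 + S\<^sup>2)\<^sup>2"
  have pos: "cmod (f t) ^ m \<le> D / (1 + t\<^sup>2)\<^sup>2" if "t \<ge> 0" for t
  proof (cases "t \<ge> S")
    case True
    then have t: "t \<ge> 1" "t \<ge> T" using S by auto
    have "cmod (f t) ^ m \<le> (C * t powr (- \<epsilon>)) ^ m" using T t by (intro power_mono) auto
    also have "\<dots> = C ^ m * t powr (- (real m * \<epsilon>))"
      using t by (simp add: power_mult_distrib powr_realpow[symmetric] powr_powr mult.commute)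
    also have "\<dots> \<le> C ^ m * t powr (- 4)"
      using m t C by (intro mult_left_mono powr_mono) auto
    also have "t powr (- 4) = 1 / (t\<^sup>2)\<^sup>2" using t by (simp add: powr_minus_divide)
    also have "1 / (t\<^sup>2)\<^sup>2 \<le> 4 / (1 + t\<^sup>2)\<^sup>2"
    proof -
      have "1 \<le> t\<^sup>2" using t by (simp add: one_le_power)
      then have "(1 + t\<^sup>2)\<^sup>2 \<le> (2 * t\<^sup>2)\<^sup>2" by (intro power_mono) auto
      then have "4 / (2 * t\<^sup>2)\<^sup>2 \<le> 4 / (1 + t\<^sup>2)\<^sup>2"
        by (rule divide_left_mono) (use t in \<open>auto intro!: mult_pos_pos zero_less_power add_pos_nonneg\<close>)
      then show ?thesis by (simp add: power_mult_distrib)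
    qed
    finally have "cmod (f t) ^ m \<le> C ^ m * (4 / (1 + t\<^sup>2)\<^sup>2)" using C by simp
    also have "\<dots> \<le> D / (1 + t\<^sup>2)\<^sup>2" by (simp add: D_def divide_right_mono mult.commute)
    finally show ?thesis .
  next
    case False
    have "cmod (f t) ^ m \<le> 1" using le1 by (simp add: power_le_one)
    also have "1 \<le> D / (1 + t\<^sup>2)\<^sup>2"
    proof -
      have "(1 + t\<^sup>2)\<^sup>2 \<le> (1 + S\<^sup>2)\<^sup>2" using False that by (intro power_mono add_left_mono) auto
      also have "\<dots> \<le> D" using C by (simp add: D_def)
      finally have "(1 + t\<^sup>2)\<^sup>2 \<le> D" .
      moreover have "0 < (1 + t\<^sup>2)\<^sup>2" by (intro zero_less_power add_pos_nonneg) auto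
      ultimately show ?thesis by (simp only: pos_le_divide_eq mult_1_left)
    qed
    finally show ?thesis .
  qed
  show thesis
  proof (rule that)
    show "cmod (f t) ^ m \<le> D / (1 + t\<^sup>2)\<^sup>2" for t
      using pos[of t] pos[of "- t"] sym[of t] by (cases "t \<ge> 0") auto
  qed
qed

subsection \<open>Locally absolutely continuous functions\<close>

text \<open>Re-indexing of the definition from initial segments of the naturals to arbitrary finite
  index sets, so that the pieces of a tagged division can index the intervals directly.\<close>

lemma loc_abs_cont_finite_set:
  fixes a b e :: real
  assumes "loc_abs_cont p" "e > 0"
  shows "\<exists>d>0. \<forall>(I :: 'i set) u v. finite I \<and> (\<forall>k\<in>I. a \<le> u k \<and> u k < v k \<and> v k \<le> b) \<and>
      (\<forall>k\<in>I. \<forall>j\<in>I. k \<noteq> j \<longrightarrow> v k \<le> u j \<or> v j \<le> u k) \<and> (\<Sum>k\<in>I. v k - u k) < d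
      \<longrightarrow> (\<Sum>k\<in>I. \<bar>p (v k) - p (u k)\<bar>) < e"
proof -
  obtain d where "d > 0" and d: "\<forall>(n::nat) (u::nat \<Rightarrow> real) v.
        (\<forall>k<n. a \<le> u k \<and> u k < v k \<and> v k \<le> b) \<and>
        (\<forall>k<n. \<forall>j<n. k \<noteq> j \<longrightarrow> v k \<le> u j \<or> v j \<le> u k) \<and>
        (\<Sum>k<n. v k - u k) < d \<longrightarrow>
        (\<Sum>k<n. \<bar>p (v k) - p (u k)\<bar>) < e"
    using assms(1)[unfolded loc_abs_cont_def, THEN spec, of a, THEN spec, of b, THEN spec, of e, THEN mp, OF assms(2)]
    by (elim exE conjE)
  show ?thesis
  proof (intro exI[of _ d] conjI allI impI \<open>d > 0\<close>; elim conjE)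
    fix I :: "'i set" and u v
    assume I: "finite I" "\<forall>k\<in>I. a \<le> u k \<and> u k < v k \<and> v k \<le> b"
      "\<forall>k\<in>I. \<forall>j\<in>I. k \<noteq> j \<longrightarrow> v k \<le> u j \<or> v j \<le> u k" "(\<Sum>k\<in>I. v k - u k) < d"
    obtain h where h: "bij_betw h {..<card I} I"
      using ex_bij_betw_nat_finite[OF I(1)] by (auto simp: atLeast0LessThan)
    have hI: "h k \<in> I" if "k < card I" for k using h that by (auto simp: bij_betw_def)
    have hne: "h k \<noteq> h j" if "k < card I" "j < card I" "k \<noteq> j" for k j
      using h that by (auto simp: bij_betw_def inj_on_def)
    have "(\<Sum>k<card I. \<bar>p (v (h k)) - p (u (h k))\<bar>) < e"
    proof (rule d[THEN spec, of "card I", THEN spec, of "\<lambda>k. u (h k)", THEN spec, of "\<lambda>k. v (h k)", THEN mp], intro conjI)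
      show "(\<Sum>k<card I. v (h k) - u (h k)) < d"
        using I(4) sum.reindex_bij_betw[OF h, of "\<lambda>k. v k - u k"] by simp
    qed (use I(2,3) hI hne in auto)
    then show "(\<Sum>k\<in>I. \<bar>p (v k) - p (u k)\<bar>) < e"
      using sum.reindex_bij_betw[OF h, of "\<lambda>k. \<bar>p (v k) - p (u k)\<bar>"] by simp
  qed
qed

text \<open>A family consisting of the single interval between \<open>x\<close> and \<open>y\<close>
  already gives continuity; \<open>unit\<close> serves as its index type.\<close>

lemma isCont_of_loc_abs_cont:
  assumes "loc_abs_cont p"
  shows "isCont p x"
  unfolding continuous_at_eps_delta
proof (intro allI impI)
  fix e :: real assume "e > 0"
  obtain d where "d > 0" and d: "\<forall>(I :: unit set) u v. finite I \<and> (\<forall>k\<in>I. x - 1 \<le> u k \<and> u k < v k \<and> v k \<le> x + 1) \<and>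
      (\<forall>k\<in>I. \<forall>j\<in>I. k \<noteq> j \<longrightarrow> v k \<le> u j \<or> v j \<le> u k) \<and> (\<Sum>k\<in>I. v k - u k) < d
      \<longrightarrow> (\<Sum>k\<in>I. \<bar>p (v k) - p (u k)\<bar>) < e"
    using loc_abs_cont_finite_set[OF assms \<open>e > 0\<close>, of "x - 1" "x + 1"] by (elim exE conjE)
  have "\<bar>p y - p x\<bar> < e" if "\<bar>y - x\<bar> < min d 1" for y
    using d[THEN spec, of "{()}", THEN spec, of "\<lambda>_. min x y", THEN spec, of "\<lambda>_. max x y"] that \<open>e > 0\<close>
    by (cases "x < y"; cases "x = y") (auto simp: min_def max_def abs_minus_commute split: if_splits)
  then show "\<exists>d>0. \<forall>x'. dist x' x < d \<longrightarrow> dist (p x') (p x) < e"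
    using \<open>d > 0\<close> by (intro exI[of _ "min d 1"]) (auto simp: dist_real_def)
qed

text \<open>
  In a fine tagged division, the tags in the exceptional null set \<open>N\<close> belong to intervals inside an open
  set of small measure, where absolute continuity controls the increments of \<open>p\<close>; the other tags are
  handled as in the usual fundamental theorem of calculus.
\<close>

lemma has_integral_of_loc_abs_cont:
  assumes ac: "loc_abs_cont p" and D: "AE x in lborel. (p has_real_derivative p' x) (at x)" and "a \<le> b"
  shows "(p' has_integral p b - p a) {a..b}"
proof (cases "a = b")
  case False
  then have "a < b" using \<open>a \<le> b\<close> by simp
  obtain N where N: "{x. \<not> (p has_real_derivative p' x) (at x)} \<subseteq> N" "emeasure lborel N = 0" "N \<in> sets borel"
    using AE_E[OF D] by auto
  \<comment> \<open>Setting the integrand to 0 on the null set \<open>N\<close> leaves the integral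
    unchanged and removes the uncontrolled values of \<open>p'\<close> from the Riemann
    sums.\<close>
  define f where "f x = (if x \<in> N then 0 else p' x)" for x
  have "(f has_integral p b - p a) {a..b}"
    unfolding has_integral_real
  proof (intro allI impI)
    fix e :: real assume "e > 0"
    define e1 where "e1 = e / (4 * (b - a))"
    have "e1 > 0" using \<open>e > 0\<close> \<open>a < b\<close> by (simp add: e1_def)
    have e2: "e / 2 > 0" using \<open>e > 0\<close> by simp
    obtain \<delta> where "\<delta> > 0" and \<delta>: "\<forall>(I :: (real \<times> real set) set) u v.
      finite I \<and> (\<forall>k\<in>I. a \<le> u k \<and> u k < v k \<and> v k \<le> b) \<and>
      (\<forall>k\<in>I. \<forall>j\<in>I. k \<noteq> j \<longrightarrow> v k \<le> u j \<or> v j \<le> u k) \<and> (\<Sum>k\<in>I. v k - u k) < \<delta>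
      \<longrightarrow> (\<Sum>k\<in>I. \<bar>p (v k) - p (u k)\<bar>) < e / 2"
      using loc_abs_cont_finite_set[OF ac e2, of a b] by (elim exE conjE)
    obtain U where U: "open U" "N \<subseteq> U" "emeasure lborel (U - N) < ennreal \<delta>"
      using outer_regular_lborel[OF N(3), of \<delta>] \<open>\<delta> > 0\<close> by auto
    have U\<delta>: "emeasure lborel U < ennreal \<delta>"
    proof -
      have "emeasure lborel U \<le> emeasure lborel (U - N) + emeasure lborel N"
        using U N by (intro order_trans[OF emeasure_mono emeasure_subadditive]) auto
      then show ?thesis using U N by simp
    qed
    have "\<exists>r>0. (x \<in> N \<longrightarrow> ball x r \<subseteq> U) \<and>
        (x \<notin> N \<longrightarrow> (\<forall>y. \<bar>y - x\<bar> < r \<longrightarrow> \<bar>p y - p x - p' x * (y - x)\<bar> \<le> e1 * \<bar>y - x\<bar>))" for x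
    proof (cases "x \<in> N")
      case True
      then show ?thesis using U openE by blast
    next
      case False
      then have "(p has_real_derivative p' x) (at x)" using N by auto
      then show ?thesis using \<open>e1 > 0\<close> False
        unfolding has_field_derivative_def has_derivative_within_alt by auto
    qed
    then obtain r where r: "\<And>x. r x > 0" "\<And>x. x \<in> N \<Longrightarrow> ball x (r x) \<subseteq> U"
      "\<And>x y. \<lbrakk>x \<notin> N; \<bar>y - x\<bar> < r x\<rbrakk> \<Longrightarrow> \<bar>p y - p x - p' x * (y - x)\<bar> \<le> e1 * \<bar>y - x\<bar>"
      by metis
    show "\<exists>\<gamma>. gauge \<gamma> \<and> (\<forall>\<D>. \<D> tagged_division_of {a..b} \<and> \<gamma> fine \<D> \<longrightarrow>
        norm (sum (\<lambda>(x,k). measure lborel k *\<^sub>R f x) \<D> - (p b - p a)) < e)"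
    proof (intro exI[of _ "\<lambda>x. ball x (r x)"] conjI allI impI, goal_cases)
      case 1
      show ?case using r(1) gauge_ball_dependent by blast
    next
      case (2 \<D>)
      then have tag: "\<D> tagged_division_of {a..b}" and fine: "(\<lambda>x. ball x (r x)) fine \<D>"
        by (rule conjunct1, rule conjunct2)
      have fin: "finite \<D>" using tag by (rule tagged_division_ofD(1))
      have K: "\<exists>u v. K = {u..v} \<and> u \<le> x \<and> x \<le> v \<and> a \<le> u \<and> v \<le> b \<and> {u..v} \<subseteq> ball x (r x)"
        if xK: "(x, K) \<in> \<D>" for x K
      proof -
        obtain u v where uv: "K = cbox u v" using tagged_division_ofD(4)[OF tag xK] by blast
        have "x \<in> K" "K \<subseteq> {a..b}" using tagged_division_ofD(2,3)[OF tag xK] .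
        moreover have "K \<subseteq> ball x (r x)" using fine xK by (rule fineD)
        ultimately show ?thesis using uv by (intro exI[of _ u] exI[of _ v]) auto
      qed
      let ?g = "\<lambda>(x, K). measure lborel K *\<^sub>R f x - (p (Sup K) - p (Inf K))"
      \<comment> \<open>Degenerate pieces are left out because absolute continuity speaks of
        intervals with \<open>u < v\<close>. They stay among the good pieces, where both their
        length and their increment are 0.\<close>
      define \<B> where "\<B> = {(x, K) \<in> \<D>. x \<in> N \<and> Inf K < Sup K}"
      have \<B>: "\<B> \<subseteq> \<D>" by (auto simp: \<B>_def)
      have "(\<Sum>(x,k)\<in>\<D>. measure lborel k *\<^sub>R f x) - (p b - p a) = sum ?g \<D>"
        using additive_tagged_division_1[OF \<open>a \<le> b\<close> tag, of p]
        by (simp add: case_prod_unfold sum_subtractf)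
      also have "\<dots> = sum ?g (\<D> - \<B>) + sum ?g \<B>"
        by (rule sum.subset_diff[OF \<B> fin])
      finally have split: "norm (sum (\<lambda>(x,k). measure lborel k *\<^sub>R f x) \<D> - (p b - p a))
          \<le> norm (sum ?g (\<D> - \<B>)) + norm (sum ?g \<B>)"
        by (simp only: norm_triangle_ineq)
      have "norm (sum ?g (\<D> - \<B>)) \<le> (\<Sum>z\<in>\<D> - \<B>. e1 * (case z of (x, K) \<Rightarrow> Sup K - Inf K))"
      proof (rule sum_norm_le)
        fix z assume z: "z \<in> \<D> - \<B>"
        obtain x K where xK: "z = (x, K)" by (cases z)
        then obtain u v where uv: "K = {u..v}" "u \<le> x" "x \<le> v" "{u..v} \<subseteq> ball x (r x)" using K[of x K] z by auto
        have "norm (?g z) \<le> e1 * (v - u)"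
        proof (cases "x \<in> N")
          case True
          then have "u = v" using z xK uv by (auto simp: \<B>_def)
          then show ?thesis using uv xK by simp
        next
          case False
          have "u \<in> ball x (r x)" "v \<in> ball x (r x)"
            using uv(2,3) subsetD[OF uv(4), of u] subsetD[OF uv(4), of v] by auto
          then have "\<bar>p u - p x - p' x * (u - x)\<bar> \<le> e1 * (x - u)" "\<bar>p v - p x - p' x * (v - x)\<bar> \<le> e1 * (v - x)"
            using r(3)[OF False, of u] r(3)[OF False, of v] uv by (auto simp: dist_real_def)
          \<comment> \<open>The increment over the piece is compared with the linear approximation
            at the tag on either side of it; the two errors add up to
            \<open>e1 * (v - u)\<close>.\<close>
          moreover have "?g z = (p u - p x - p' x * (u - x)) - (p v - p x - p' x * (v - x))"
            using uv xK False by (simp add: f_def algebra_simps)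
          ultimately show ?thesis by (simp only: real_norm_def right_diff_distrib)
        qed
        then show "norm (?g z) \<le> e1 * (case z of (x, K) \<Rightarrow> Sup K - Inf K)" using uv xK by simp
      qed
      also have "\<dots> \<le> (\<Sum>z\<in>\<D>. e1 * (case z of (x, K) \<Rightarrow> Sup K - Inf K))"
        using fin \<open>e1 > 0\<close> by (intro sum_mono2) (auto dest!: K)
      also have "\<dots> = e1 * (b - a)"
        using additive_tagged_division_1[OF \<open>a \<le> b\<close> tag, of "\<lambda>x. x"] by (simp add: sum_distrib_left[symmetric])
      also have "\<dots> = e / 4" using \<open>a < b\<close> by (simp add: e1_def field_simps)
      finally have good: "norm (sum ?g (\<D> - \<B>)) \<le> e / 4" .
      have KB: "\<exists>u v. K = {u..v} \<and> u \<le> x \<and> x \<le> v \<and> a \<le> u \<and> v \<le> b \<and> {u..v} \<subseteq> U \<and> u < v"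
        if "(x, K) \<in> \<B>" for x K
      proof -
        have x: "(x, K) \<in> \<D>" "x \<in> N" "Inf K < Sup K" using that by (auto simp: \<B>_def)
        then obtain u v where "K = {u..v}" "u \<le> x" "x \<le> v" "a \<le> u" "v \<le> b" "{u..v} \<subseteq> ball x (r x)"
          using K by blast
        then show ?thesis using x r(2)[OF x(2)] by (intro exI[of _ u] exI[of _ v]) auto
      qed
      have disj: "interior (snd z) \<inter> interior (snd z') = {}" if "z \<in> \<B>" "z' \<in> \<B>" "z \<noteq> z'" for z z'
        using that \<B> tagged_division_ofD(5)[OF tag, of "fst z" "snd z" "fst z'" "snd z'"] by (auto simp: prod_eq_iff)
      have "(\<Sum>z\<in>\<B>. \<bar>p (Sup (snd z)) - p (Inf (snd z))\<bar>) < e / 2"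
      proof (rule \<delta>[THEN spec, of \<B>, THEN spec, of "\<lambda>z. Inf (snd z)", THEN spec, of "\<lambda>z. Sup (snd z)", THEN mp],
          intro conjI ballI impI)
        show "finite \<B>" using fin \<B> finite_subset by blast
        fix z assume "z \<in> \<B>"
        then show "a \<le> Inf (snd z)" "Inf (snd z) < Sup (snd z)" "Sup (snd z) \<le> b"
          using KB[of "fst z" "snd z"] by auto
      next
        fix z z' assume z: "z \<in> \<B>" "z' \<in> \<B>" "z \<noteq> z'"
        obtain u v u' v' where uv: "snd z = {u..v}" "u < v" "snd z' = {u'..v'}" "u' < v'"
          using KB[of "fst z" "snd z"] KB[of "fst z'" "snd z'"] z by auto
        then have "{u<..<v} \<inter> {u'<..<v'} = {}" using disj[OF z] by (simp add: interior_atLeastAtMost_real)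
        then have "max u u' \<ge> min v v'"
          by (metis Int_greaterThanLessThan greaterThanLessThan_empty_iff inf_real_def sup_real_def)
        then show "Sup (snd z) \<le> Inf (snd z') \<or> Sup (snd z') \<le> Inf (snd z)"
          using uv by (auto simp: min_def max_def split: if_splits)
      next
        \<comment> \<open>The pieces may share endpoints, so their total length is measured through
          the interiors, which are disjoint subsets of \<open>U\<close>.\<close>
        have "ennreal (\<Sum>z\<in>\<B>. Sup (snd z) - Inf (snd z)) = (\<Sum>z\<in>\<B>. ennreal (Sup (snd z) - Inf (snd z)))"
          by (rule sum_ennreal[symmetric]) (use KB in fastforce)
        also have "\<dots> = (\<Sum>z\<in>\<B>. emeasure lborel (interior (snd z)))"
        proof (rule sum.cong[OF refl])
          fix z assume "z \<in> \<B>"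
          then obtain u v where "snd z = {u..v}" "u < v" using KB[of "fst z" "snd z"] by auto
          then show "ennreal (Sup (snd z) - Inf (snd z)) = emeasure lborel (interior (snd z))"
            by (simp add: interior_atLeastAtMost_real)
        qed
        also have "\<dots> = emeasure lborel (\<Union>z\<in>\<B>. interior (snd z))"
          by (rule sum_emeasure) (use fin \<B> finite_subset disj in \<open>auto simp: disjoint_family_on_def\<close>)
        also have "\<dots> \<le> emeasure lborel U"
        proof (rule emeasure_mono)
          show "(\<Union>z\<in>\<B>. interior (snd z)) \<subseteq> U"
            using KB interior_subset by fastforce
        qed (use U in auto)
        also have "\<dots> < ennreal \<delta>" by (rule U\<delta>)
        finally show "(\<Sum>z\<in>\<B>. Sup (snd z) - Inf (snd z)) < \<delta>"
          by (meson ennreal_leI not_le)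
      qed
      moreover have "norm (sum ?g \<B>) \<le> (\<Sum>z\<in>\<B>. \<bar>p (Sup (snd z)) - p (Inf (snd z))\<bar>)"
        by (rule sum_norm_le) (auto simp: \<B>_def f_def)
      ultimately show ?case using split good \<open>e > 0\<close> by linarith
    qed
  qed
  moreover have "negligible N"
    using N by (simp add: negligible_iff_null_sets null_sets_def emeasure_completion null_setsI)
  ultimately show ?thesis
    using has_integral_spike[of N "{a..b}" p' f] by (auto simp: f_def)
qed auto

subsection \<open>Bounded variation\<close>

text \<open>The point \<open>a\<close> is null, so the bound can be stated on the half-open
  interval; such intervals fit together without overlap when increments are summed.\<close>

lemma abs_le_integral_Ioc:
  fixes q :: "real \<Rightarrow> real"
  assumes "integrable lborel q" "(q has_integral I) {a..b}"
  shows "\<bar>I\<bar> \<le> (LINT x|lborel. indicator {a<..b} x * \<bar>q x\<bar>)"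
proof -
  have si: "set_integrable lborel {a..b} q"
    unfolding set_integrable_def by (rule integrable_mult_indicator) (use assms(1) in auto)
  have "I = (LINT x:{a..b}|lborel. q x)"
    using set_borel_integral_eq_integral(2)[OF si] assms(2) by (simp add: integral_unique)
  also have "\<bar>\<dots>\<bar> \<le> (LINT x|lborel. \<bar>indicator {a..b} x *\<^sub>R q x\<bar>)"
    unfolding set_lebesgue_integral_def by (rule integral_abs_bound)
  also have "\<dots> = (LINT x|lborel. indicator {a<..b} x * \<bar>q x\<bar>)"
  proof (rule integral_cong_AE)
    show "AE x in lborel. \<bar>indicator {a..b} x *\<^sub>R q x\<bar> = indicator {a<..b} x * \<bar>q x\<bar>"
      using AE_lborel_singleton[of a] by eventually_elim (auto simp: indicator_def)
  qed (use assms(1) in auto)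
  finally show ?thesis .
qed

text \<open>The half-open intervals between successive points tile \<open>{x 0<..x n}\<close>, so
  every sum of increments is at most the integral of \<open>g\<close> over the line.\<close>

lemma bounded_total_variationI:
  assumes g: "integrable lborel g" "\<And>x. 0 \<le> g x"
    and le: "\<And>a b. a < b \<Longrightarrow> \<bar>p b - p a\<bar> \<le> (LINT x|lborel. indicator {a<..b} x * g x)"
  shows "bounded_total_variation p"
  unfolding bounded_total_variation_def
proof (intro exI allI impI)
  fix n :: nat and x :: "nat \<Rightarrow> real"
  assume x: "\<forall>k<n. x k < x (Suc k)"
  have int: "integrable lborel (\<lambda>y. indicator {a<..b} y * g y)" for a b
    using integrable_mult_indicator[of "{a<..b}" lborel g] g by simp
  have mono: "x 0 \<le> x m" if "m \<le> n" for m
    using that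
  proof (induction m)
    case (Suc m)
    then show ?case using x[THEN spec, of m] by simp
  qed simp
  have ind: "(\<Sum>k<m. indicator {x k<..x (Suc k)} y) = indicat_real {x 0<..x m} y" if "m \<le> n" for m y
    using that
  proof (induction m)
    case (Suc m)
    then show ?case using mono[of m] x by (auto simp: indicator_def less_Suc_eq_le Suc_le_eq split: if_splits)
  qed simp
  have "(\<Sum>k<n. \<bar>p (x (Suc k)) - p (x k)\<bar>) \<le> (\<Sum>k<n. LINT y|lborel. indicator {x k<..x (Suc k)} y * g y)"
    using x by (intro sum_mono le) auto
  also have "\<dots> = (LINT y|lborel. (\<Sum>k<n. indicator {x k<..x (Suc k)} y * g y))"
    by (rule Bochner_Integration.integral_sum[symmetric]) (rule int)
  also have "\<dots> = (LINT y|lborel. indicator {x 0<..x n} y * g y)"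
    by (simp add: sum_distrib_right[symmetric] ind)
  also have "\<dots> \<le> (LINT y|lborel. g y)"
    by (rule integral_mono[OF int g(1)]) (use g(2) in \<open>auto simp: indicator_def\<close>)
  finally show "(\<Sum>k<n. \<bar>p (x (Suc k)) - p (x k)\<bar>) \<le> (LINT y|lborel. g y)" .
qed

lemma between_one_sided_limits_of_isCont:
  assumes "\<And>x. isCont p x"
  shows "between_one_sided_limits p"
  unfolding between_one_sided_limits_def
proof
  fix x
  show "\<exists>l r. (p \<longlongrightarrow> l) (at_left x) \<and> (p \<longlongrightarrow> r) (at_right x) \<and> min l r \<le> p x \<and> p x \<le> max l r"
    using assms[of x] by (intro exI[of _ "p x"]) (auto simp: isCont_def filterlim_at_split)
qed

lemma bounded_total_variation_of_C1:
  assumes D: "\<And>x. (p has_real_derivative p' x) (at x)" and int: "integrable lborel p'"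
  shows "bounded_total_variation p"
proof (rule bounded_total_variationI)
  show "integrable lborel (\<lambda>x. \<bar>p' x\<bar>)" using int by simp
  fix a b :: real assume "a < b"
  then have "(p' has_integral p b - p a) {a..b}"
    using D by (intro fundamental_theorem_of_calculus) (auto simp: has_real_derivative_iff_has_vector_derivative[symmetric] has_field_derivative_at_within)
  then show "\<bar>p b - p a\<bar> \<le> (LINT x|lborel. indicator {a<..b} x * \<bar>p' x\<bar>)"
    by (rule abs_le_integral_Ioc[OF int])
qed simp

text \<open>The inequality between \<open>2 * a * b\<close> and \<open>a^2 + b^2\<close> gives
  \<open>\<bar>p'\<bar> \<le> p'^2 / p + p\<close> where \<open>p\<close> is positive. The Fisher
  integrand says nothing about the zeros of \<open>p\<close>, but there \<open>p\<close> has a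
  minimum and its derivative vanishes.\<close>

lemma integrable_deriv_of_fisher:
  assumes nonneg: "\<And>x. 0 \<le> p x" and int: "integrable lborel p" and [measurable]: "p' \<in> borel_measurable borel"
    and D: "AE x in lborel. (p has_real_derivative p' x) (at x)"
    and fin: "(\<integral>\<^sup>+ x. indicator {x. 0 < p x} x * ennreal ((p' x)\<^sup>2 / p x) \<partial>lborel) < \<infinity>"
  shows "integrable lborel p'"
proof (rule integrableI_bounded)
  have [measurable]: "p \<in> borel_measurable borel" using int by auto
  have "(\<integral>\<^sup>+ x. ennreal (norm (p' x)) \<partial>lborel) \<le>
     (\<integral>\<^sup>+ x. indicator {x. 0 < p x} x * ennreal ((p' x)\<^sup>2 / p x) + ennreal (p x) \<partial>lborel)"
  proof (rule nn_integral_mono_AE)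
    show "AE x in lborel. ennreal (norm (p' x)) \<le> indicator {x. 0 < p x} x * ennreal ((p' x)\<^sup>2 / p x) + ennreal (p x)"
      using D
    proof eventually_elim
      case (elim x)
      show ?case
      proof (cases "p x = 0")
        case True
        have "p' x = 0" using True nonneg by (intro DERIV_local_min[OF elim, of 1]) auto
        then show ?thesis by simp
      next
        case False
        then have pos: "0 < p x" using nonneg[of x] by simp
        have "2 * (\<bar>p' x\<bar> * p x) \<le> (p' x)\<^sup>2 + (p x)\<^sup>2"
          using sum_squares_bound[of "\<bar>p' x\<bar>" "p x"] by simp
        moreover have "0 \<le> \<bar>p' x\<bar> * p x" using pos by simp
        ultimately have "\<bar>p' x\<bar> * p x \<le> (p' x)\<^sup>2 + (p x)\<^sup>2" by linarith
        then have "\<bar>p' x\<bar> \<le> (p' x)\<^sup>2 / p x + p x"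
          using pos by (simp add: field_simps power2_eq_square)
        then show ?thesis using pos by (simp add: ennreal_plus[symmetric] ennreal_leI del: ennreal_plus)
      qed
    qed
  qed
  also have "\<dots> = (\<integral>\<^sup>+ x. indicator {x. 0 < p x} x * ennreal ((p' x)\<^sup>2 / p x) \<partial>lborel) + (\<integral>\<^sup>+ x. ennreal (p x) \<partial>lborel)"
    by (rule nn_integral_add) auto
  also have "\<dots> < \<infinity>"
    using fin nn_integral_eq_integral[OF int] nonneg by (simp add: ennreal_add_less_top)
  finally show "(\<integral>\<^sup>+ x. ennreal (norm (p' x)) \<partial>lborel) < \<infinity>" .
qed simp

text \<open>The definition of \<open>has_density\<close> has \<open>lborel\<close> as target, while
  characteristic functions are taken of laws over \<open>borel\<close>; both carry the same
  sigma-algebra, so the law is the same.\<close>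

lemma has_density_integrable:
  assumes "has_density M Y p" "prob_space M"
  shows "integrable lborel p" "p \<in> borel_measurable borel" "distr M borel Y = density lborel (\<lambda>x. ennreal (p x))"
proof -
  have nonneg: "0 \<le> p x" for x using assms by (simp add: has_density_def)
  have d: "distributed M lborel Y (\<lambda>x. ennreal (p x))" using assms by (simp add: has_density_def)
  have "(\<lambda>x. enn2real (ennreal (p x))) \<in> borel_measurable borel"
    using distributed_borel_measurable[OF d] by (intro borel_measurable_enn2real) simp
  then show m: "p \<in> borel_measurable borel" using nonneg by simp
  have "distr M lborel Y = density lborel (\<lambda>x. ennreal (p x))"
    by (rule distributed_distr_eq_density[OF d])
  then show eq: "distr M borel Y = density lborel (\<lambda>x. ennreal (p x))"
    by (simp cong: distr_cong)
  have "Y \<in> borel_measurable M" using distributed_measurable[OF d] by simp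
  then have "(\<integral>\<^sup>+ x. ennreal (p x) \<partial>lborel) = 1"
    using prob_space.emeasure_space_1[OF prob_space.prob_space_distr[OF assms(2), of Y borel]] m
    by (simp add: eq emeasure_density)
  then show "integrable lborel p"
    using m nonneg by (intro integrableI_bounded) auto
qed

lemma has_densityI:
  assumes "\<And>x. 0 \<le> p x" "p \<in> borel_measurable borel" "Y \<in> borel_measurable M" "distr M borel Y = density lborel (\<lambda>x. ennreal (p x))"
  shows "has_density M Y p"
proof -
  have "distr M lborel Y = distr M borel Y" by (rule distr_cong) auto
  then show ?thesis using assms by (simp add: has_density_def distributed_def)
qed

text \<open>An almost everywhere derivative alone does not control increments; local absolute
  continuity makes \<open>p b - p a\<close> the integral of \<open>p'\<close>, and finite Fisher
  information makes \<open>p'\<close> integrable.\<close>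

lemma bounded_variation_of_fisher:
  assumes "finite_fisher_info M Y" "prob_space M"
  shows "\<exists>p. has_density M Y p \<and> between_one_sided_limits p \<and> bounded_total_variation p"
proof -
  obtain p p' where p: "has_density M Y p" "loc_abs_cont p" "p' \<in> borel_measurable borel"
    "AE x in lborel. (p has_real_derivative p' x) (at x)"
    "(\<integral>\<^sup>+ x. indicator {x. 0 < p x} x * ennreal ((p' x)\<^sup>2 / p x) \<partial>lborel) < \<infinity>"
    using assms(1) unfolding finite_fisher_info_def by blast
  have int: "integrable lborel p'"
    by (rule integrable_deriv_of_fisher[OF _ has_density_integrable(1)[OF p(1) assms(2)] p(3-5)])
      (use p(1) in \<open>simp add: has_density_def\<close>)
  have "bounded_total_variation p"
  proof (rule bounded_total_variationI)
    show "integrable lborel (\<lambda>x. \<bar>p' x\<bar>)" using int by simp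
    fix a b :: real assume "a < b"
    then show "\<bar>p b - p a\<bar> \<le> (LINT x|lborel. indicator {a<..b} x * \<bar>p' x\<bar>)"
      by (intro abs_le_integral_Ioc[OF int] has_integral_of_loc_abs_cont p) simp
  qed simp
  then show ?thesis using p between_one_sided_limits_of_isCont isCont_of_loc_abs_cont by blast
qed

section \<open>Decay of the characteristic function under bounded variation\<close>

text \<open>Consecutive blocks of length \<open>h\<close> are translated onto
  \<open>{0..<h}\<close>, so that sums along arithmetic progressions of step \<open>h\<close> appear
  under the integral.\<close>

lemma nn_integral_blocks:
  fixes g :: "real \<Rightarrow> ennreal"
  assumes [measurable]: "g \<in> borel_measurable borel" and "0 \<le> h"
  shows "(\<integral>\<^sup>+x. g x * indicator {s..<s + real n * h} x \<partial>lborel) =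
    (\<integral>\<^sup>+x. (\<Sum>k<n. g (s + real k * h + x)) * indicator {0..<h} x \<partial>lborel)"
proof (induction n)
  case (Suc n)
  have nh: "0 \<le> real n * h" using \<open>0 \<le> h\<close> by simp
  have "(\<integral>\<^sup>+x. g x * indicator {s..<s + real (Suc n) * h} x \<partial>lborel) =
    (\<integral>\<^sup>+x. g x * indicator {s..<s + real n * h} x + g x * indicator {s + real n * h..<s + real n * h + h} x \<partial>lborel)"
  proof (rule nn_integral_cong)
    fix x
    define r where "r = s + real n * h"
    have "s \<le> r" "s + real (Suc n) * h = r + h" using nh by (simp_all add: r_def algebra_simps)
    then show "g x * indicator {s..<s + real (Suc n) * h} x =
        g x * indicator {s..<s + real n * h} x + g x * indicator {s + real n * h..<s + real n * h + h} x"
      using \<open>0 \<le> h\<close> unfolding r_def[symmetric] by (auto simp: indicator_def)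
  qed
  also have "\<dots> = (\<integral>\<^sup>+x. g x * indicator {s..<s + real n * h} x \<partial>lborel)
      + (\<integral>\<^sup>+x. g x * indicator {s + real n * h..<s + real n * h + h} x \<partial>lborel)"
    by (rule nn_integral_add) auto
  also have "(\<integral>\<^sup>+x. g x * indicator {s + real n * h..<s + real n * h + h} x \<partial>lborel)
      = (\<integral>\<^sup>+x. g (s + real n * h + x) * indicator {0..<h} x \<partial>lborel)"
    by (subst nn_integral_real_affine[where c=1 and t="s + real n * h"])
       (auto intro!: nn_integral_cong simp: indicator_def)
  also have "(\<integral>\<^sup>+x. g x * indicator {s..<s + real n * h} x \<partial>lborel) + \<dots> =
     (\<integral>\<^sup>+x. (\<Sum>k<n. g (s + real k * h + x)) * indicator {0..<h} x + g (s + real n * h + x) * indicator {0..<h} x \<partial>lborel)"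
    unfolding Suc by (rule nn_integral_add[symmetric]) auto
  finally show ?case by (simp add: distrib_right)
qed simp

text \<open>For fixed \<open>x\<close>, the increments of \<open>p\<close> along a progression of
  step \<open>h\<close> form a variation sum, hence add up to at most \<open>B\<close>. Integrating
  over the starting point in \<open>{0..<h}\<close> gives \<open>B * h\<close>.\<close>

lemma nn_integral_increment_le:
  fixes p :: "real \<Rightarrow> real"
  assumes [measurable]: "p \<in> borel_measurable borel" and "0 < h"
    and B: "\<And>(n::nat) (x::nat \<Rightarrow> real). (\<forall>k<n. x k < x (Suc k)) \<Longrightarrow> (\<Sum>k<n. \<bar>p (x (Suc k)) - p (x k)\<bar>) \<le> B"
  shows "(\<integral>\<^sup>+x. ennreal \<bar>p (x + h) - p x\<bar> \<partial>lborel) \<le> ennreal (B * h)"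
proof -
  have B0: "0 \<le> B" using B[of 0] by simp
  let ?g = "\<lambda>x. ennreal \<bar>p (x + h) - p x\<bar>"
  \<comment> \<open>These are \<open>2 * n\<close> blocks starting at \<open>- (real n * h)\<close>;
    they increase to the whole line, and monotone convergence passes to the limit.\<close>
  let ?A = "\<lambda>n::nat. {- (real n * h)..<- (real n * h) + real (2 * n) * h}"
  have A: "?A n = {- (real n * h)..<real n * h}" for n by (auto simp: algebra_simps)
  have le: "(\<integral>\<^sup>+x. ?g x * indicator (?A n) x \<partial>lborel) \<le> ennreal (B * h)" for n
  proof -
    have "(\<integral>\<^sup>+x. ?g x * indicator (?A n) x \<partial>lborel) =
      (\<integral>\<^sup>+x. (\<Sum>k<2*n. ?g (- (real n * h) + real k * h + x)) * indicator {0..<h} x \<partial>lborel)"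
      by (rule nn_integral_blocks) (use \<open>0 < h\<close> in auto)
    also have "\<dots> \<le> (\<integral>\<^sup>+x. ennreal B * indicator {0..<h} x \<partial>lborel)"
    proof (intro nn_integral_mono mult_right_mono)
      fix x
      define y where "y k = - (real n * h) + real k * h + x" for k
      have "(\<Sum>k<2*n. \<bar>p (y (Suc k)) - p (y k)\<bar>) \<le> B"
        by (rule B) (use \<open>0 < h\<close> in \<open>auto simp: y_def algebra_simps\<close>)
      moreover have "y (Suc k) = y k + h" for k by (simp add: y_def algebra_simps)
      ultimately show "(\<Sum>k<2*n. ?g (- (real n * h) + real k * h + x)) \<le> ennreal B"
        unfolding y_def[symmetric] by (simp add: ennreal_leI)
    qed auto
    also have "\<dots> = ennreal (B * h)" using B0 \<open>0 < h\<close> by (simp add: nn_integral_cmult ennreal_mult)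
    finally show ?thesis .
  qed
  have "(\<integral>\<^sup>+x. ?g x \<partial>lborel) \<le> (\<integral>\<^sup>+x. (SUP n. ?g x * indicator (?A n) x) \<partial>lborel)"
  proof (rule nn_integral_mono)
    fix x
    obtain n :: nat where "\<bar>x\<bar> / h < real n" using reals_Archimedean2 by blast
    then have "x \<in> ?A n" unfolding A using \<open>0 < h\<close> by (auto simp: field_simps abs_less_iff)
    then show "?g x \<le> (SUP n. ?g x * indicator (?A n) x)"
      by (intro SUP_upper2[of n]) auto
  qed
  also have "\<dots> = (SUP n. \<integral>\<^sup>+x. ?g x * indicator (?A n) x \<partial>lborel)"
  proof (rule nn_integral_monotone_convergence_SUP)
    show "incseq (\<lambda>n x. ?g x * indicator (?A n) x)"
    proof (intro incseq_SucI le_funI mult_left_mono)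
      fix n x
      have "real n * h \<le> real (Suc n) * h" using \<open>0 < h\<close> by (intro mult_right_mono) auto
      moreover have "{- r..<r} \<subseteq> {- R..<R}" if "r \<le> R" for r R :: real using that by auto
      ultimately have "?A n \<subseteq> ?A (Suc n)" unfolding A[of n] A[of "Suc n"] by blast
      moreover have "indicator S x \<le> (indicator T x :: ennreal)" if "S \<subseteq> T" for S T :: "real set"
        using that by (auto simp: indicator_def)
      ultimately show "indicator (?A n) x \<le> (indicator (?A (Suc n)) x :: ennreal)" by blast
    qed simp
  qed auto
  also have "\<dots> \<le> ennreal (B * h)" by (rule SUP_least) (rule le)
  finally show ?thesis .
qed

lemma char_decay_of_bounded_variation:
  assumes int: "integrable lborel p" and nonneg: "\<And>x. 0 \<le> p x"
    and B: "\<And>(n::nat) (x::nat \<Rightarrow> real). (\<forall>k<n. x k < x (Suc k)) \<Longrightarrow> (\<Sum>k<n. \<bar>p (x (Suc k)) - p (x k)\<bar>) \<le> B"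
    and "0 < t"
  shows "cmod (char (density lborel (\<lambda>x. ennreal (p x))) t) \<le> B * pi / (2 * t)"
proof -
  have [measurable]: "p \<in> borel_measurable borel" using int by auto
  \<comment> \<open>With \<open>t * h = pi\<close>, a shift of the variable by \<open>h\<close>
    multiplies the exponential by -1.\<close>
  define h where "h = pi / t"
  have h: "h > 0" "t * h = pi" using \<open>0 < t\<close> by (auto simp: h_def)
  have B0: "0 \<le> B" using B[of 0] by simp
  let ?q = "\<lambda>x. complex_of_real (p x)"
  have intq: "integrable lborel (\<lambda>x. ?q x * iexp (t * x))"
    by (intro integrable_mult_iexp integrable_of_real int) simp
  have inth: "integrable lborel (\<lambda>x. p (x + h))"
    using lborel_integrable_real_affine[OF int, of 1 h] by (simp add: add.commute)
  have intqh: "integrable lborel (\<lambda>x. ?q (x + h) * iexp (t * x))"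
    by (intro integrable_mult_iexp integrable_of_real inth) simp
  have c: "char (density lborel (\<lambda>x. ennreal (p x))) t = (CLINT x|lborel. ?q x * iexp (t * x))"
    unfolding char_def using nonneg by (subst integral_density) (auto simp: scaleR_conv_of_real)
  also have "\<dots> = (CLINT x|lborel. ?q (x + h) * iexp (t * (x + h)))"
    using lborel_integral_real_affine[of 1 "\<lambda>x. ?q x * iexp (t * x)" h] by (simp add: add.commute)
  also have "\<dots> = (CLINT x|lborel. - (?q (x + h) * iexp (t * x)))"
  proof (rule Bochner_Integration.integral_cong)
    have "iexp (t * (x + h)) = - iexp (t * x)" for x
    proof -
      have "iexp (t * (x + h)) = iexp (t * x) * exp (\<i> * complex_of_real (t * h))"
        by (simp add: distrib_left exp_add)
      then show ?thesis unfolding h(2) by simp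
    qed
    then show "?q (x + h) * iexp (t * (x + h)) = - (?q (x + h) * iexp (t * x))" for x
      by (simp only: mult_minus_right)
  qed simp
  finally have c': "char (density lborel (\<lambda>x. ennreal (p x))) t = - (CLINT x|lborel. ?q (x + h) * iexp (t * x))"
    by simp
  \<comment> \<open>Adding the unshifted and the shifted expression for the same value leaves an
    integral of increments, to which the bound \<open>B * h\<close> applies.\<close>
  have "2 * char (density lborel (\<lambda>x. ennreal (p x))) t =
      (CLINT x|lborel. ?q x * iexp (t * x)) - (CLINT x|lborel. ?q (x + h) * iexp (t * x))"
    using c c' by simp
  also have "\<dots> = (CLINT x|lborel. ?q x * iexp (t * x) - ?q (x + h) * iexp (t * x))"
    by (rule Bochner_Integration.integral_diff[symmetric, OF intq intqh])
  also have "\<dots> = (CLINT x|lborel. complex_of_real (p x - p (x + h)) * iexp (t * x))"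
    by (simp add: left_diff_distrib)
  finally have "2 * cmod (char (density lborel (\<lambda>x. ennreal (p x))) t) =
     cmod (CLINT x|lborel. complex_of_real (p x - p (x + h)) * iexp (t * x))"
    by (metis norm_mult norm_numeral)
  also have "\<dots> \<le> (LINT x|lborel. cmod (complex_of_real (p x - p (x + h))))"
    by (rule norm_integral_iexp_le)
  also have "\<dots> = (LINT x|lborel. \<bar>p (x + h) - p x\<bar>)"
    by (simp only: norm_of_real abs_minus_commute)
  also have "\<dots> \<le> B * h"
  proof -
    have "ennreal (LINT x|lborel. \<bar>p (x + h) - p x\<bar>) = (\<integral>\<^sup>+x. ennreal \<bar>p (x + h) - p x\<bar> \<partial>lborel)"
      by (rule nn_integral_eq_integral[symmetric]) (use int inth in auto)
    also have "\<dots> \<le> ennreal (B * h)" by (rule nn_integral_increment_le) (use h B in auto)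
    finally show ?thesis using B0 h by (simp add: ennreal_le_iff)
  qed
  finally have "2 * cmod (char (density lborel (\<lambda>x. ennreal (p x))) t) \<le> B * h" .
  then show ?thesis using \<open>0 < t\<close> by (simp add: h_def field_simps)
qed

subsection \<open>Equivalence of the five conditions\<close>

lemma le_powr_inverse:
  fixes x y a :: real
  assumes "0 \<le> x" "0 < a" "x powr a \<le> y"
  shows "x \<le> y powr (1 / a)"
proof -
  have "x = (x powr a) powr (1 / a)" using assms by (simp add: powr_powr)
  also have "\<dots> \<le> y powr (1 / a)" using assms by (intro powr_mono2) auto
  finally show ?thesis .
qed

text \<open>Factoring out \<open>iexp (s * x)\<close>, which has modulus 1, reduces the claim to
  \<open>cmod (iexp u - 1) \<le> \<bar>u\<bar>\<close> with \<open>u = (t - s) * x\<close>.\<close>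

lemma (in real_distribution) char_lipschitz:
  assumes "integrable M (\<lambda>x. x)"
  shows "cmod (char M t - char M s) \<le> (LINT x|M. \<bar>x\<bar>) * \<bar>t - s\<bar>"
proof -
  have int: "integrable M (\<lambda>x. iexp (u * x))" for u
    by (rule integrable_iexp) (auto simp del: of_real_mult)
  have le: "cmod (iexp (t * x) - iexp (s * x)) \<le> \<bar>t - s\<bar> * \<bar>x\<bar>" for x
  proof -
    have "iexp (t * x) = iexp (s * x) * iexp ((t - s) * x)"
      by (simp add: exp_add[symmetric] algebra_simps)
    then have "cmod (iexp (t * x) - iexp (s * x)) = cmod (iexp (s * x) * (iexp ((t - s) * x) - 1))"
      by (simp only: right_diff_distrib mult_1_right)
    also have "\<dots> = cmod (iexp ((t - s) * x) - 1)"
      by (simp only: norm_mult norm_exp_i_times mult_1_left)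
    also have "\<dots> \<le> \<bar>(t - s) * x\<bar>" using iexp_approx1[of "(t - s) * x" 0] by simp
    finally show ?thesis by (simp only: abs_mult)
  qed
  have "cmod (char M t - char M s) = cmod (CLINT x|M. iexp (t * x) - iexp (s * x))"
    unfolding char_def by (subst Bochner_Integration.integral_diff[OF int int]) simp
  also have "\<dots> \<le> (LINT x|M. cmod (iexp (t * x) - iexp (s * x)))"
    by (rule integral_norm_bound)
  also have "\<dots> \<le> (LINT x|M. \<bar>t - s\<bar> * \<bar>x\<bar>)"
    by (rule integral_mono)
       (intro integrable_norm Bochner_Integration.integrable_diff int, use assms in simp, rule le)
  finally show ?thesis by (simp add: mult.commute)
qed

text \<open>With \<open>m = cmod (f t)\<close>, the modulus stays at least \<open>m / 2\<close> on
  an interval of length \<open>m / (2 * l)\<close> to the right of \<open>t\<close>. The integral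
  over this interval alone gives \<open>(m / 2) powr (\<nu> + 1) \<le> r * l / t\<close>, where
  \<open>r\<close> is the full integral.\<close>

lemma bigo_powr_of_lipschitz:
  fixes f :: "real \<Rightarrow> complex"
  assumes lip: "\<And>s t. cmod (f t - f s) \<le> L * \<bar>t - s\<bar>" and "\<nu> > 0"
    and fin: "(\<integral>\<^sup>+ t. ennreal (cmod (f t) powr \<nu> * \<bar>t\<bar>) \<partial>lborel) < \<infinity>"
  shows "(\<lambda>t. cmod (f t)) \<in> O[at_top](\<lambda>t. t powr (- (1 / (\<nu> + 1))))"
proof -
  \<comment> \<open>A strictly positive Lipschitz constant, so that it can be divided by.\<close>
  define l where "l = \<bar>L\<bar> + 1"
  have l: "l > 0" "cmod (f t - f s) \<le> l * \<bar>t - s\<bar>" for s t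
    using order_trans[OF lip mult_right_mono[of L l "\<bar>t - s\<bar>"]] by (auto simp: l_def)
  define r where "r = enn2real (\<integral>\<^sup>+ t. ennreal (cmod (f t) powr \<nu> * \<bar>t\<bar>) \<partial>lborel)"
  have r: "0 \<le> r" "(\<integral>\<^sup>+ t. ennreal (cmod (f t) powr \<nu> * \<bar>t\<bar>) \<partial>lborel) = ennreal r"
    using fin by (auto simp: r_def less_top)
  have "cmod (f t) \<le> (2 * (r * l) powr (1 / (\<nu> + 1))) * t powr (- (1 / (\<nu> + 1)))" if "t \<ge> 1" for t
  proof -
    define m where "m = cmod (f t)"
    have m: "0 \<le> m" by (simp add: m_def)
    have half: "m / 2 \<le> cmod (f s)" if "s \<in> {t..t + m / (2 * l)}" for s
    proof -
      have "m - cmod (f s) \<le> cmod (f t - f s)" unfolding m_def by (rule norm_triangle_ineq2)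
      also have "\<dots> \<le> l * \<bar>t - s\<bar>" by (rule l(2))
      also have "\<dots> \<le> l * (m / (2 * l))" using that l(1) by (intro mult_left_mono) auto
      also have "\<dots> = m / 2" using l(1) by simp
      finally show ?thesis by simp
    qed
    have "ennreal ((m / 2) powr \<nu> * t * (m / (2 * l))) = (\<integral>\<^sup>+ s. ennreal ((m / 2) powr \<nu> * t) * indicator {t..t + m / (2 * l)} s \<partial>lborel)"
      using m l(1) that by (simp add: nn_integral_cmult ennreal_mult[symmetric])
    also have "\<dots> \<le> (\<integral>\<^sup>+ s. ennreal (cmod (f s) powr \<nu> * \<bar>s\<bar>) \<partial>lborel)"
    proof (rule nn_integral_mono)
      fix s
      have "(m / 2) powr \<nu> * t \<le> cmod (f s) powr \<nu> * \<bar>s\<bar>" if "s \<in> {t..t + m / (2 * l)}"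
        using half[OF that] that m \<open>t \<ge> 1\<close> \<open>\<nu> > 0\<close> by (intro mult_mono powr_mono2) auto
      then show "ennreal ((m / 2) powr \<nu> * t) * indicator {t..t + m / (2 * l)} s \<le> ennreal (cmod (f s) powr \<nu> * \<bar>s\<bar>)"
        by (auto simp: indicator_def intro: ennreal_leI)
    qed
    also have "\<dots> = ennreal r" by (rule r(2))
    finally have "(m / 2) powr \<nu> * t * (m / (2 * l)) \<le> r" using r(1) by simp
    then have "(m / 2) powr \<nu> * (m / 2) \<le> r * l / t"
      using l(1) that by (simp add: field_simps)
    then have "(m / 2) powr (\<nu> + 1) \<le> r * l / t" using m by (simp add: powr_add)
    then have "m / 2 \<le> (r * l / t) powr (1 / (\<nu> + 1))"
      using m \<open>\<nu> > 0\<close> by (intro le_powr_inverse) auto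
    also have "\<dots> = (r * l) powr (1 / (\<nu> + 1)) * t powr (- (1 / (\<nu> + 1)))"
      using r(1) l(1) that by (simp add: powr_divide powr_minus_divide)
    finally show ?thesis by (simp add: m_def)
  qed
  then show ?thesis
    by (intro bigoI[of _ "2 * (r * l) powr (1 / (\<nu> + 1))"] eventually_at_top_linorderI[of 1]) simp
qed

lemma integrable_power_of_decay:
  fixes f :: "real \<Rightarrow> complex"
  assumes "\<And>t. cmod (f t) ^ m \<le> D / (1 + t\<^sup>2)\<^sup>2" "0 < m"
  shows "(\<integral>\<^sup>+ t. ennreal (cmod (f t) powr real m * \<bar>t\<bar>) \<partial>lborel) < \<infinity>"
proof -
  have D0: "0 \<le> D" using order_trans[OF _ assms(1)[of 0]] by simp
  have "(\<integral>\<^sup>+ t. ennreal (cmod (f t) powr real m * \<bar>t\<bar>) \<partial>lborel) \<le> (\<integral>\<^sup>+ t. ennreal (D * (1 / (1 + t\<^sup>2))) \<partial>lborel)"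
  proof (intro nn_integral_mono ennreal_leI)
    fix t :: real
    have "\<bar>t\<bar> \<le> 1 + t\<^sup>2" using sum_squares_bound[of "\<bar>t\<bar>" 1] by (simp add: power2_eq_square)
    then have "cmod (f t) ^ m * \<bar>t\<bar> \<le> D / (1 + t\<^sup>2)\<^sup>2 * (1 + t\<^sup>2)"
      using assms(1) D0 by (intro mult_mono) auto
    also have "\<dots> = D * (1 / (1 + t\<^sup>2))" by (simp add: power2_eq_square)
    \<comment> \<open>Positivity of \<open>m\<close> matters at zeros of \<open>f\<close>: there
      \<open>0 powr 0\<close> is 0 while the natural power with exponent 0 is 1.\<close>
    finally show "cmod (f t) powr real m * \<bar>t\<bar> \<le> D * (1 / (1 + t\<^sup>2))"
      using \<open>0 < m\<close> by (simp add: powr_realpow')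
  qed
  also have "\<dots> = ennreal (LINT t|lborel. D * (1 / (1 + t\<^sup>2)))"
    using D0 by (intro nn_integral_eq_integral integrable_mult_right integrable_inverse_1_plus_square_lborel) auto
  finally show ?thesis by (simp add: le_less_trans[OF _ ennreal_less_top])
qed

section \<open>Characteristic functions and densities of normalized sums\<close>

lemma cmod_char_minus: "cmod (char M (- t)) = cmod (char M t)"
proof -
  have "char M (- t) = cnj (char M t)"
    unfolding char_def Bochner_Integration.integral_cnj[of M "\<lambda>x. iexp (t * x)", symmetric] by (simp add: exp_cnj)
  then show ?thesis by simp
qed

lemma char_distr_divide:
  assumes "Y \<in> borel_measurable M"
  shows "char (distr M borel (\<lambda>\<omega>. Y \<omega> / c)) t = char (distr M borel Y) (t / c)"
  using assms unfolding char_def by (simp add: integral_distr)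

lemma (in prob_space) char_normalized_sum:
  fixes X :: "nat \<Rightarrow> 'a \<Rightarrow> real"
  assumes rv: "\<And>i. X i \<in> borel_measurable M"
    and indep: "indep_vars (\<lambda>_. borel) X UNIV"
    and ident: "\<And>i. distr M borel (X i) = distr M borel (X 0)"
  shows "char (distr M borel (\<lambda>\<omega>. (\<Sum>i<n. X i \<omega>) / c)) t = char (distr M borel (X 0)) (t / c) ^ n"
proof -
  have "char (distr M borel (\<lambda>\<omega>. (\<Sum>i<n. X i \<omega>) / c)) t = char (distr M borel (\<lambda>\<omega>. \<Sum>i<n. X i \<omega>)) (t / c)"
    by (rule char_distr_divide) (use rv in simp)
  also have "\<dots> = (\<Prod>i<n. char (distr M borel (X i)) (t / c))"
    by (rule char_distr_sum[OF indep_vars_subset[OF indep]]) simp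
  also have "\<dots> = char (distr M borel (X 0)) (t / c) ^ n"
    by (subst ident) simp
  finally show ?thesis .
qed

text \<open>The law of the normalized sum of \<open>m + 2\<close> variables has as characteristic
  function the power \<open>m + 2\<close> of that of \<open>X 0 / sqrt n\<close>, where
  \<open>n = m + 2\<close>. The rescaled variable keeps its second moment and the decay.\<close>

lemma (in prob_space) smooth_density_of_normalized_sum:
  fixes X :: "nat \<Rightarrow> 'a \<Rightarrow> real"
  assumes rv: "\<And>i. X i \<in> borel_measurable M"
    and indep: "indep_vars (\<lambda>_. borel) X UNIV"
    and ident: "\<And>i. distr M borel (X i) = distr M borel (X 0)"
    and second_moment: "integrable M (\<lambda>\<omega>. (X 0 \<omega>)\<^sup>2)"
    and decay: "\<And>t. cmod (char (distr M borel (X 0)) t) ^ m \<le> D / (1 + t\<^sup>2)\<^sup>2"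
  obtains p p' p'' :: "real \<Rightarrow> real" and c where
    "has_density M (\<lambda>\<omega>. (\<Sum>i<m+2. X i \<omega>) / sqrt (real (m+2))) p"
    "\<And>x. (p has_real_derivative p' x) (at x)" "\<And>x. (p' has_real_derivative p'' x) (at x)"
    "\<And>x. \<bar>p' x\<bar> \<le> c / (1 + x\<^sup>2)" "\<And>x. \<bar>p'' x\<bar> \<le> c / (1 + x\<^sup>2)"
proof -
  define n where "n = real (m + 2)"
  have n: "n \<ge> 1" by (simp add: n_def)
  let ?Z = "\<lambda>\<omega>. (\<Sum>i<m+2. X i \<omega>) / sqrt n"
  let ?N = "distr M borel (\<lambda>\<omega>. X 0 \<omega> / sqrt n)"
  have Z: "?Z \<in> borel_measurable M" using rv by simp
  have D0: "0 \<le> D" using order_trans[OF _ decay[of 0]] by simp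
  interpret Z: real_distribution "distr M borel ?Z" using Z by (rule real_distribution_distr)
  have N: "real_distribution ?N" using rv by (intro real_distribution_distr) simp
  have N2: "integrable ?N (\<lambda>x. x\<^sup>2)"
    using rv second_moment by (simp add: integrable_distr_eq power_divide)
  have char_N: "char ?N t = char (distr M borel (X 0)) (t / sqrt n)" for t
    by (rule char_distr_divide[OF rv])
  have charZ: "char (distr M borel ?Z) t = char ?N t ^ (m + 2)" for t
    unfolding char_N by (rule char_normalized_sum[OF rv indep ident])
  \<comment> \<open>Rescaling the argument by \<open>sqrt n\<close> costs the factor
    \<open>n^2\<close>; the final estimate uses \<open>1 + t^2 \<le> n + t^2\<close>.\<close>
  have decN: "cmod (char ?N t) ^ m \<le> (D * n\<^sup>2) / (1 + t\<^sup>2)\<^sup>2" for t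
  proof -
    have "cmod (char ?N t) ^ m \<le> D / (1 + t\<^sup>2 / n)\<^sup>2"
      unfolding char_N using decay[of "t / sqrt n"] n by (simp add: power_divide)
    also have "\<dots> = (D * n\<^sup>2) / (n + t\<^sup>2)\<^sup>2"
      using n by (simp add: divide_simps power_divide add_pos_nonneg)
    also have "\<dots> \<le> (D * n\<^sup>2) / (1 + t\<^sup>2)\<^sup>2"
      using n D0 by (intro divide_left_mono power_mono mult_pos_pos zero_less_power) (auto simp: add_pos_nonneg)
    finally show ?thesis .
  qed
  obtain p p' p'' c where p: "\<And>x. 0 \<le> p x" "distr M borel ?Z = density lborel (\<lambda>x. ennreal (p x))"
    "\<And>x. (p has_real_derivative p' x) (at x)" "\<And>x. (p' has_real_derivative p'' x) (at x)"
    "\<And>x. \<bar>p' x\<bar> \<le> c / (1 + x\<^sup>2)" "\<And>x. \<bar>p'' x\<bar> \<le> c / (1 + x\<^sup>2)"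
    using Z.smooth_density_of_char_power[OF N N2 charZ decN] by blast
  have "p \<in> borel_measurable borel"
    using p(3) by (intro borel_measurable_continuous_onI continuous_at_imp_continuous_on) (blast intro: DERIV_isCont)
  then show thesis
    using that[OF _ p(3-6)] has_densityI[OF p(1) _ Z p(2)] by (simp add: n_def)
qed

theorem theorem1p3:
  fixes M :: "'a measure" and X :: "nat \<Rightarrow> 'a \<Rightarrow> real"
    and Z :: "nat \<Rightarrow> 'a \<Rightarrow> real" and f1 :: "real \<Rightarrow> complex"
  assumes "prob_space M"
    and rv: "\<And>i. X i \<in> borel_measurable M"
    and indep: "prob_space.indep_vars M (\<lambda>_. borel) X UNIV"
    and ident: "\<And>i. distr M borel (X i) = distr M borel (X 0)"
    and second_moment: "integrable M (\<lambda>\<omega>. (X 0 \<omega>)\<^sup>2)"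
    and f1_def: "f1 = char (distr M borel (X 0))"
    and Z_def: "\<And>n \<omega>. Z n \<omega> = (\<Sum>i<n. X i \<omega>) / sqrt (real n)"
  shows
    "((\<exists>n0\<ge>1. finite_fisher_info M (Z n0))
       \<longleftrightarrow> (\<exists>n0\<ge>1. \<exists>p. has_density M (Z n0) p \<and> between_one_sided_limits p
                          \<and> bounded_total_variation p))
   \<and> ((\<exists>n0\<ge>1. \<exists>p. has_density M (Z n0) p \<and> between_one_sided_limits p
                          \<and> bounded_total_variation p)
       \<longleftrightarrow> (\<exists>n0\<ge>1. \<exists>p p'. has_density M (Z n0) p
                          \<and> (\<forall>x. (p has_real_derivative p' x) (at x)) \<and> continuous_on UNIV p'
                          \<and> integrable lborel p'))
   \<and> ((\<exists>n0\<ge>1. \<exists>p p'. has_density M (Z n0) p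
                          \<and> (\<forall>x. (p has_real_derivative p' x) (at x)) \<and> continuous_on UNIV p'
                          \<and> integrable lborel p')
       \<longleftrightarrow> (\<exists>\<epsilon>>0. (\<lambda>t. cmod (f1 t)) \<in> O[at_top](\<lambda>t. t powr (- \<epsilon>))))
   \<and> ((\<exists>\<epsilon>>0. (\<lambda>t. cmod (f1 t)) \<in> O[at_top](\<lambda>t. t powr (- \<epsilon>)))
       \<longleftrightarrow> (\<exists>\<nu>>0. (\<integral>\<^sup>+ t. ennreal (cmod (f1 t) powr \<nu> * \<bar>t\<bar>) \<partial>lborel) < \<infinity>))"
    (is "(?a \<longleftrightarrow> ?b) \<and> (?b \<longleftrightarrow> ?c) \<and> (?c \<longleftrightarrow> ?d) \<and> (?d \<longleftrightarrow> ?e)")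
proof -
  interpret prob_space M by fact
  interpret F: real_distribution "distr M borel (X 0)" using rv by (rule real_distribution_distr)
  have Z_eq: "Z n = (\<lambda>\<omega>. (\<Sum>i<n. X i \<omega>) / sqrt (real n))" for n using Z_def by blast
  have charZ: "char (distr M borel (Z n)) t = f1 (t / sqrt (real n)) ^ n" for n t
    unfolding Z_eq f1_def by (rule char_normalized_sum[OF rv indep ident])
  have ab: "?a \<Longrightarrow> ?b" using bounded_variation_of_fisher \<open>prob_space M\<close> by blast
  have cb: "?c \<Longrightarrow> ?b"
    using bounded_total_variation_of_C1 between_one_sided_limits_of_isCont DERIV_isCont by blast
  have bd: ?d if b: ?b
  proof -
    obtain n p where n: "n \<ge> 1" and p: "has_density M (Z n) p" "bounded_total_variation p"
      using b by blast
    obtain B where B: "\<And>(n::nat) (x::nat \<Rightarrow> real). (\<forall>k<n. x k < x (Suc k)) \<Longrightarrow> (\<Sum>k<n. \<bar>p (x (Suc k)) - p (x k)\<bar>) \<le> B"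
      using p(2) unfolding bounded_total_variation_def by blast
    have B0: "0 \<le> B" using B[of 0] by simp
    define C where "C = B * pi / (2 * sqrt (real n))"
    have C0: "0 \<le> C" using B0 by (simp add: C_def)
    \<comment> \<open>Evaluating the characteristic function of \<open>Z n\<close> at
      \<open>s * sqrt n\<close> undoes the normalization and gives a bound on
      \<open>f1 s ^ n\<close>; the root of order \<open>n\<close> yields the exponent
      \<open>1 / n\<close>.\<close>
    have le: "cmod (f1 s) \<le> C powr (1 / real n) * s powr (- (1 / real n))" if "s \<ge> 1" for s
    proof -
      have "cmod (char (distr M borel (Z n)) (s * sqrt (real n))) \<le> B * pi / (2 * (s * sqrt (real n)))"
        unfolding has_density_integrable(3)[OF p(1) \<open>prob_space M\<close>]
        by (rule char_decay_of_bounded_variation[OF has_density_integrable(1)[OF p(1) \<open>prob_space M\<close>] _ B])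
           (use p(1) n that in \<open>auto simp: has_density_def\<close>)
      then have "cmod (f1 s) ^ n \<le> C / s"
        using n by (simp add: charZ norm_power C_def mult_ac)
      then have "cmod (f1 s) powr real n \<le> C / s" using n by (simp add: powr_realpow')
      then have "cmod (f1 s) \<le> (C / s) powr (1 / real n)" using n by (intro le_powr_inverse) auto
      also have "\<dots> = C powr (1 / real n) * s powr (- (1 / real n))"
        using C0 that by (simp add: powr_divide powr_minus_divide)
      finally show ?thesis .
    qed
    have "(\<lambda>t. cmod (f1 t)) \<in> O[at_top](\<lambda>t. t powr (- (1 / real n)))"
      by (rule bigoI[of _ "C powr (1 / real n)"]) (use le in \<open>auto intro!: eventually_at_top_linorderI[of 1]\<close>)
    then show ?d using n by (intro exI[of _ "1 / real n"]) auto
  qed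
  have dD: "\<exists>m D. 0 < m \<and> (\<forall>t. cmod (f1 t) ^ m \<le> D / (1 + t\<^sup>2)\<^sup>2)" if d: ?d
  proof -
    obtain \<epsilon> where e: "\<epsilon> > 0" "(\<lambda>t. cmod (f1 t)) \<in> O[at_top](\<lambda>t. t powr (- \<epsilon>))" using d by blast
    \<comment> \<open>The exponent is large enough to turn decay of order \<open>\<epsilon>\<close>
      into decay of order at least 4.\<close>
    define m where "m = nat \<lceil>4 / \<epsilon>\<rceil>"
    have "4 / \<epsilon> \<le> real m" unfolding m_def by (rule real_nat_ceiling_ge)
    then have m: "4 \<le> real m * \<epsilon>" using e(1) by (simp add: field_simps)
    then have "0 < m" by (cases m) auto
    moreover obtain D where "\<And>t. cmod (f1 t) ^ m \<le> D / (1 + t\<^sup>2)\<^sup>2"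
      by (rule char_power_decay[OF e(2,1) _ _ m]) (auto simp: f1_def F.cmod_char_le_1 cmod_char_minus)
    ultimately show ?thesis by blast
  qed
  have dac: "?a \<and> ?c" if d: ?d
  proof -
    obtain m D where D: "\<And>t. cmod (f1 t) ^ m \<le> D / (1 + t\<^sup>2)\<^sup>2" using dD[OF d] by blast
    obtain p p' p'' c where p: "has_density M (Z (m + 2)) p"
      "\<And>x. (p has_real_derivative p' x) (at x)" "\<And>x. (p' has_real_derivative p'' x) (at x)"
      "\<And>x. \<bar>p' x\<bar> \<le> c / (1 + x\<^sup>2)" "\<And>x. \<bar>p'' x\<bar> \<le> c / (1 + x\<^sup>2)"
      unfolding Z_eq
      using smooth_density_of_normalized_sum[OF rv indep ident second_moment D[unfolded f1_def]] by blast
    have nonneg: "\<And>x. 0 \<le> p x" using p(1) by (simp add: has_density_def)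
    have cont: "continuous_on UNIV p'" using p(3) DERIV_isCont continuous_at_imp_continuous_on by blast
    then have meas: "p' \<in> borel_measurable borel" by (rule borel_measurable_continuous_onI)
    have c0: "0 \<le> c" using order_trans[OF abs_ge_zero p(4)[of 0]] by simp
    have bd: "\<bar>p' x\<bar> \<le> c" for x
    proof -
      have "c / (1 + x\<^sup>2) \<le> c / 1" using c0 by (intro divide_left_mono) (auto simp: add_pos_nonneg)
      then show ?thesis using p(4)[of x] by simp
    qed
    have "finite_fisher_info M (Z (m + 2))"
      unfolding finite_fisher_info_def
      using p(1) loc_abs_cont_of_bounded_deriv[OF p(2) bd] meas p(2) fisher_integral_finite[OF nonneg p(2-5)]
      by (intro exI[of _ p] exI[of _ p']) auto
    moreover have "integrable lborel p'"
      using p(4) by (intro integrable_of_norm_le_1_plus_square[OF meas]) simp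
    moreover have "m + 2 \<ge> 1" by simp
    ultimately show ?thesis using p(1,2) cont by blast
  qed
  have de: ?e if d: ?d
  proof -
    obtain m D where m: "0 < m" "\<And>t. cmod (f1 t) ^ m \<le> D / (1 + t\<^sup>2)\<^sup>2" using dD[OF d] by blast
    then show ?e using integrable_power_of_decay[OF m(2,1)] by (intro exI[of _ "real m"]) simp
  qed
  have ed: ?d if e: ?e
  proof -
    obtain \<nu> where nu: "\<nu> > 0" "(\<integral>\<^sup>+ t. ennreal (cmod (f1 t) powr \<nu> * \<bar>t\<bar>) \<partial>lborel) < \<infinity>" using e by blast
    \<comment> \<open>On a probability space the second moment bounds the first, which supplies the
      Lipschitz constant.\<close>
    have "integrable M (X 0)"
      using square_integrable_imp_integrable[OF rv second_moment] .
    then have "integrable (distr M borel (X 0)) (\<lambda>x. x)" using rv by (simp add: integrable_distr_eq)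
    from bigo_powr_of_lipschitz[OF F.char_lipschitz[OF this], folded f1_def, OF nu]
    show ?d using nu(1) by (intro exI[of _ "1 / (\<nu> + 1)"]) auto
  qed
  \<comment> \<open>The implications (a) to (b), (c) to (b), (b) to (d), (d) to both (a) and (c),
    together with (d) to (e) and back, connect all five conditions.\<close>
  show ?thesis using ab cb bd dac de ed by argo
qed

end
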